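(* Let $m>n\geq 2$ both be even. Then the $m$-linear $O(n,\mathbb C)$-invariant $\tilde g=\tilde g_{n\times m}$ is indecomposable in the ring $R^{O(n,\mathbb C)}(\mathbb Z)$.
   Context: Write $n=2\nu$ and $m=2\mu$. **Groups.** Coordinates on $\mathbb C^n$ are $x_1,y_1,\dots,x_\nu,y_\nu$, and $q=x_1y_1+\dots+x_\nu y_\nu$. $O(n,\mathbb C)$ is the group of linear automorphisms of $\mathbb C^n$ preserving $q$. **Invariants.** $R=R_{n\times m}$ is the $\mathbb C$-algebra of polynomials in the coordinates $x_r^{(i)},y_r^{(i)}$ of indeterminate $n$-dimensional vectors $v^{(1)},\dots,v^{(m)}$, and $R(\mathbb Z)$ is its subring of polynomials with integer coefficients. For $G=O(n,\mathbb C)$, $R^G$ is the subalgebra of polynomials invariant under the simultaneous action of $G$ on $m$-tuples of vectors, and $R^G(\mathbb Z)=R^G\cap R(\mathbb Z)$. A polynomial is $m$-linear if it is multilinear in $v^{(1)},\dots,v^{(m)}$. An element of $R^G(\mathbb Z)$ is indecomposable if it is not contained in the subring of $R^G(\mathbb Z)$ generated by the elements of $R^G(\mathbb Z)$ of lower degree (i.e. of total degree strictly less than that of the given element). **The polynomial $\tilde g$.** Let $B^{(ij)}=\sum_{r=1}^\nu(x_r^{(i)}y_r^{(j)}+y_r^{(i)}x_r^{(j)})$ for $1\le i,j\le m$, and let $\mathrm{Pf}^{(1,\dots,2\mu)}$ be the Pfaffian of the $2\mu\times2\mu$ skew-symmetric matrix whose $(i,j)$ entry for $i<j$ is $B^{(ij)}$.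 Put $\tilde g=2^{-(\mu-\nu)}\,\mathrm{Pf}^{(1,\dots,2\mu)}$; it is an $O(n,\mathbb C)$-invariant with integer coefficients. *)

theory Defs
  imports
    Complex_Main
    "HOL.Hull"
    "HOL-Library.Poly_Mapping"
    "HOL-Combinatorics.Permutations"
    "Jordan_Normal_Form.Matrix"
begin

text \<open>
  All indices start at \<open>0\<close>. The variable \<open>(i, k)\<close> is the \<open>k\<close>-th coordinate of the \<open>i\<close>-th vector,
  the coordinates of a vector being listed as \<open>x\<^sub>0, y\<^sub>0, x\<^sub>1, y\<^sub>1, \<dots>\<close>. Throughout,
  \<open>n\<close> and \<open>m\<close> stand for even numbers, with \<open>\<nu> = n div 2\<close> and \<open>\<mu> = m div 2\<close>.
\<close>

type_synonym monom = "(nat \<times> nat) \<Rightarrow>\<^sub>0 nat"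
type_synonym cpoly = "monom \<Rightarrow>\<^sub>0 complex"

definition cconst :: "complex \<Rightarrow> cpoly" where
  "cconst c = Poly_Mapping.single 0 c"

definition cvar :: "nat \<Rightarrow> nat \<Rightarrow> cpoly" where
  "cvar i k = Poly_Mapping.single (Poly_Mapping.single (i, k) 1) 1"

definition xvar :: "nat \<Rightarrow> nat \<Rightarrow> cpoly" where
  "xvar r i = cvar i (2 * r)"

definition yvar :: "nat \<Rightarrow> nat \<Rightarrow> cpoly" where
  "yvar r i = cvar i (2 * r + 1)"

definition monom_degree :: "monom \<Rightarrow> nat" where
  "monom_degree s = (\<Sum>a\<in>Poly_Mapping.keys s. Poly_Mapping.lookup s a)"

text \<open>The zero polynomial gets degree \<open>0\<close>.\<close>

definition total_degree :: "cpoly \<Rightarrow> nat" where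
  "total_degree f = Max (insert 0 (monom_degree ` Poly_Mapping.keys f))"

definition poly_at :: "cpoly \<Rightarrow> (nat \<Rightarrow> complex vec) \<Rightarrow> complex" where
  "poly_at f v = (\<Sum>s\<in>Poly_Mapping.keys f. Poly_Mapping.lookup f s *
     (\<Prod>(i, k)\<in>Poly_Mapping.keys s. (v i $ k) ^ Poly_Mapping.lookup s (i, k)))"

definition R :: "nat \<Rightarrow> nat \<Rightarrow> cpoly set" where
  "R n m = {f. \<forall>s\<in>Poly_Mapping.keys f. Poly_Mapping.keys s \<subseteq> {..<m} \<times> {..<n}}"

definition R_int :: "nat \<Rightarrow> nat \<Rightarrow> cpoly set" where
  "R_int n m = {f \<in> R n m. \<forall>s. Poly_Mapping.lookup f s \<in> \<int>}"

definition quad :: "nat \<Rightarrow> complex vec \<Rightarrow> complex" where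
  "quad n v = (\<Sum>r<n div 2. v $ (2 * r) * v $ (2 * r + 1))"

definition orth_group :: "nat \<Rightarrow> complex mat set" where
  "orth_group n = {A \<in> carrier_mat n n. invertible_mat A \<and>
     (\<forall>v\<in>carrier_vec n. quad n (A *\<^sub>v v) = quad n v)}"

definition invariants :: "nat \<Rightarrow> nat \<Rightarrow> cpoly set" where
  "invariants n m = {f \<in> R n m. \<forall>A\<in>orth_group n. \<forall>v. (\<forall>i<m. v i \<in> carrier_vec n) \<longrightarrow>
     poly_at f (\<lambda>i. A *\<^sub>v v i) = poly_at f v}"

definition invariants_int :: "nat \<Rightarrow> nat \<Rightarrow> cpoly set" where
  "invariants_int n m = invariants n m \<inter> R_int n m"

definition m_linear :: "nat \<Rightarrow> nat \<Rightarrow> cpoly \<Rightarrow> bool" where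
  "m_linear n m f \<longleftrightarrow> f \<in> R n m \<and>
     (\<forall>v. (\<forall>i<m. v i \<in> carrier_vec n) \<longrightarrow>
       (\<forall>i<m. \<forall>u\<in>carrier_vec n. \<forall>w\<in>carrier_vec n. \<forall>a b.
         poly_at f (v(i := a \<cdot>\<^sub>v u + b \<cdot>\<^sub>v w)) =
           a * poly_at f (v(i := u)) + b * poly_at f (v(i := w))))"

definition is_subring :: "'a::ring_1 set \<Rightarrow> bool" where
  "is_subring S \<longleftrightarrow> 1 \<in> S \<and> (\<forall>a\<in>S. \<forall>b\<in>S. a - b \<in> S \<and> a * b \<in> S)"

text \<open>\<open>is_subring hull X\<close> is the subring generated by \<open>X\<close>.\<close>

definition indecomposable :: "nat \<Rightarrow> nat \<Rightarrow> cpoly \<Rightarrow> bool" where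
  "indecomposable n m f \<longleftrightarrow> f \<in> invariants_int n m \<and>
     f \<notin> is_subring hull {h \<in> invariants_int n m. total_degree h < total_degree f}"

text \<open>
  The Pfaffian of a skew-symmetric \<open>2p \<times> 2p\<close> matrix as the sum over perfect matchings of
  \<open>{..<2p}\<close>. A matching \<open>{{\<sigma> 0, \<sigma> 1}, {\<sigma> 2, \<sigma> 3}, \<dots>}\<close> is represented by the permutation \<open>\<sigma>\<close>
  that lists each pair in increasing order and the pairs in increasing order of their first elements.
\<close>

definition matching_perms :: "nat \<Rightarrow> (nat \<Rightarrow> nat) set" where
  "matching_perms p = {\<sigma>. \<sigma> permutes {..<2 * p} \<and>
     (\<forall>k<p. \<sigma> (2 * k) < \<sigma> (2 * k + 1)) \<and>
     (\<forall>k. k + 1 < p \<longrightarrow> \<sigma> (2 * k) < \<sigma> (2 * (k + 1)))}"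

definition pfaffian :: "nat \<Rightarrow> (nat \<Rightarrow> nat \<Rightarrow> 'a::comm_ring_1) \<Rightarrow> 'a" where
  "pfaffian p M = (\<Sum>\<sigma>\<in>matching_perms p.
     of_int (sign \<sigma>) * (\<Prod>k<p. M (\<sigma> (2 * k)) (\<sigma> (2 * k + 1))))"

definition B :: "nat \<Rightarrow> nat \<Rightarrow> nat \<Rightarrow> cpoly" where
  "B n i j = (\<Sum>r<n div 2. xvar r i * yvar r j + yvar r i * xvar r j)"

definition skew_B :: "nat \<Rightarrow> nat \<Rightarrow> nat \<Rightarrow> cpoly" where
  "skew_B n i j = (if i < j then B n i j else if j < i then - B n j i else 0)"

definition g_tilde :: "nat \<Rightarrow> nat \<Rightarrow> cpoly" where
  "g_tilde n m =
     cconst (2 powi (- (int (m div 2) - int (n div 2)))) * pfaffian (m div 2) (skew_B n)"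

end

theory Submission
  imports Defs
    "Jordan_Normal_Form.Determinant"
    "HOL-Computational_Algebra.Polynomial"
begin

text \<open>
  Write \<open>n = 2\<nu>\<close> and \<open>m = 2\<mu>\<close>, and let \<open>x\<^sub>r, y\<^sub>r\<close> be the basis of the \<open>r\<close>-th hyperbolic plane.

  Integrality of \<open>g_tilde\<close>: its coefficients are, up to the factor \<open>2^-(\<mu>-\<nu>)\<close>, the Pfaffians of
  lists of \<open>2\<mu>\<close> isotropic basis vectors. As the bilinear form is symmetric, these Pfaffians satisfy
  the Clifford relation: exchanging two neighbours \<open>u, w\<close> changes the sign, up to twice \<open>B(u,w)\<close>
  times the Pfaffian of the shorter list (\<open>list_pf_swap\<close>). Since there are only \<open>2\<nu>\<close> basis vectors,
  a list of length \<open>2k > 2\<nu>\<close> contains a repetition; moving equal vectors together shows by induction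
  that the Pfaffian of a list of length \<open>2k\<close> is divisible by \<open>2^(k-\<nu>)\<close> (\<open>list_pf_dvd\<close>).

  Indecomposability: a functional on the integral invariants is exhibited that is even on the
  subring generated by the invariants of lower degree and takes the value \<open>1\<close> at \<open>g_tilde\<close>. It is
  the value of the \<open>m\<close>-linear part at one fixed tuple, which consists of \<open>y\<^sub>0\<close>, of \<open>m - n + 1\<close>
  copies of \<open>x\<^sub>0 + y\<^sub>0\<close>, and of the bases of the other planes (\<open>probe\<close>). The \<open>m\<close>-linear part of a
  product \<open>f * g\<close> is the sum of products of the multilinear parts of \<open>f\<close> and \<open>g\<close> in complementary
  sets of vectors, and these parts are again invariant and integral (\<open>mlpart_mult\<close>,
  \<open>mlpart_invariant\<close>). In each product one of the two factors is even: a part using \<open>x\<^sub>0 + y\<^sub>0\<close> but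
  not the lone \<open>y\<^sub>0\<close> is even because exchanging \<open>x\<^sub>0\<close> and \<open>y\<^sub>0\<close> pairs equal integers
  (\<open>mlpart_probe_even_without_0\<close>); a part using all vectors from plane \<open>0\<close> but not all other basis
  vectors is even because the remaining room can be used by a unipotent element mixing two planes,
  which reduces to the previous case (\<open>mlpart_probe_even_incomplete\<close>). So the integral invariants
  with even value form a subring, which contains the invariants of degree less than \<open>m\<close>, because
  those have no \<open>m\<close>-linear part. The value at \<open>g_tilde\<close> is a Pfaffian that can be expanded directly
  (\<open>poly_at_g_tilde_probe\<close>).
\<close>

section \<open>A recursive Pfaffian of a symmetric function on lists\<close>

text \<open>
  \<open>alt_sum f xs\<close> is \<open>\<Sum>j. (-1)^j f (x\<^sub>j) (xs without position j)\<close>, the shape of an expansion along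
  the first row. As a recursion on \<open>xs\<close> it makes double expansions accessible to induction, without
  any renumbering of positions.
\<close>

primrec alt_sum :: "('a \<Rightarrow> 'a list \<Rightarrow> 'b::ring_1) \<Rightarrow> 'a list \<Rightarrow> 'b" where
  "alt_sum f [] = 0"
| "alt_sum f (x # xs) = f x xs - alt_sum (\<lambda>y ys. f y (x # ys)) xs"

lemma alt_sum_add: "alt_sum (\<lambda>y ys. f y ys + g y ys) xs = alt_sum f xs + alt_sum g xs"
  by (induction xs arbitrary: f g) (simp_all add: algebra_simps)

lemma alt_sum_diff: "alt_sum (\<lambda>y ys. f y ys - g y ys) xs = alt_sum f xs - alt_sum g xs"
  by (induction xs arbitrary: f g) (simp_all add: algebra_simps)

lemma alt_sum_mult_left: "alt_sum (\<lambda>y ys. c * f y ys) xs = c * alt_sum f xs"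
  by (induction xs arbitrary: f) (simp_all add: algebra_simps)

lemma alt_sum_cong:
  assumes "\<And>us y ws. xs = us @ y # ws \<Longrightarrow> f y (us @ ws) = g y (us @ ws)"
  shows "alt_sum f xs = alt_sum g xs"
  using assms
proof (induction xs arbitrary: f g)
  case (Cons x xs)
  have "f x xs = g x xs" using Cons.prems[of "[]"] by simp
  moreover have "alt_sum (\<lambda>y ys. f y (x # ys)) xs = alt_sum (\<lambda>y ys. g y (x # ys)) xs"
  proof (rule Cons.IH)
    fix us y ws assume "xs = us @ y # ws"
    then show "f y (x # us @ ws) = g y (x # us @ ws)" using Cons.prems[of "x # us" y ws] by simp
  qed
  ultimately show ?case by simp
qed simp

lemma alt_sum_append:
  "alt_sum f (us @ ws) = alt_sum (\<lambda>y ys. f y (ys @ ws)) us + (-1) ^ length us * alt_sum (\<lambda>y ys. f y (us @ ys)) ws"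
  by (induction us arbitrary: f) (simp_all add: algebra_simps)

text \<open>
  Removing first \<open>y\<close> and then \<open>z\<close>, or first \<open>z\<close> and then \<open>y\<close>, leaves the same list; whichever of the
  two stands further to the right is at a position lower by one if it is removed second. So the two
  orders enter with opposite signs.
\<close>

lemma alt_sum_twice_antisym:
  "alt_sum (\<lambda>y ys. alt_sum (\<lambda>z zs. h y z zs) ys) xs = - alt_sum (\<lambda>y ys. alt_sum (\<lambda>z zs. h z y zs) ys) xs"
proof (induction xs arbitrary: h)
  case (Cons x xs)
  show ?case
    using Cons.IH[of "\<lambda>y z zs. h y z (x # zs)"] by (simp add: alt_sum_diff)
qed simp

lemma alt_sum_conv_sum:
  "alt_sum f xs = (\<Sum>j<length xs. (-1) ^ j * f (xs ! j) (take j xs @ drop (Suc j) xs))"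
proof (induction xs arbitrary: f)
  case (Cons x xs)
  show ?case
    by (simp add: Cons.IH sum.lessThan_Suc_shift sum_negf del: sum.lessThan_Suc)
qed simp

text \<open>
  Only the values \<open>b x y\<close> with \<open>x\<close> before \<open>y\<close> in the list enter. So \<open>list_pf b k xs\<close> is the Pfaffian
  of the skew-symmetric matrix whose part above the diagonal is given by \<open>b\<close>, even when \<open>b\<close> itself
  is symmetric, which is the case of interest.
\<close>

primrec list_pf :: "('a \<Rightarrow> 'a \<Rightarrow> 'b::comm_ring_1) \<Rightarrow> nat \<Rightarrow> 'a list \<Rightarrow> 'b" where
  "list_pf b 0 xs = 1"
| "list_pf b (Suc k) xs = alt_sum (\<lambda>y ys. b (hd xs) y * list_pf b k ys) (tl xs)"

lemma list_pf_cong_sorted: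
  assumes "sorted_wrt P xs" and "\<And>x y. P x y \<Longrightarrow> b x y = c x y" and "length xs = 2 * k"
  shows "list_pf b k xs = list_pf c k xs"
  using assms(1,3)
proof (induction k arbitrary: xs)
  case (Suc k)
  then obtain u us where xs: "xs = u # us" by (cases xs) auto
  have "alt_sum (\<lambda>y ys. b u y * list_pf b k ys) us = alt_sum (\<lambda>y ys. c u y * list_pf c k ys) us"
  proof (rule alt_sum_cong)
    fix vs y ws assume us: "us = vs @ y # ws"
    have "P u y" using Suc.prems by (simp add: xs us)
    moreover have "list_pf b k (vs @ ws) = list_pf c k (vs @ ws)"
      by (rule Suc.IH) (use Suc.prems in \<open>auto simp: xs us sorted_wrt_append\<close>)
    ultimately show "b u y * list_pf b k (vs @ ws) = c u y * list_pf c k (vs @ ws)"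
      by (simp add: assms(2))
  qed
  then show ?case by (simp add: xs)
qed simp

lemma alt_sum_map: "alt_sum f (map g xs) = alt_sum (\<lambda>y ys. f (g y) (map g ys)) xs"
  by (induction xs arbitrary: f) simp_all

lemma list_pf_map: "length xs = 2 * k \<Longrightarrow> list_pf b k (map g xs) = list_pf (\<lambda>x y. b (g x) (g y)) k xs"
proof (induction k arbitrary: xs)
  case (Suc k)
  then obtain u us where xs: "xs = u # us" by (cases xs) auto
  show ?case unfolding xs
    apply (simp add: alt_sum_map)
    apply (rule alt_sum_cong)
    using Suc by (simp add: xs flip: map_append)
qed simp

lemma alt_sum_hom:
  assumes "\<And>x y. h (x - y) = h x - h y" "h 0 = 0"
  shows "h (alt_sum f xs) = alt_sum (\<lambda>y ys. h (f y ys)) xs"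
  by (induction xs arbitrary: f) (simp_all add: assms)

lemma list_pf_hom:
  assumes "\<And>x y. h (x - y) = h x - h y" "h 0 = 0" "h 1 = 1" "\<And>x y. h (x * y) = h x * h y"
  shows "h (list_pf b k xs) = list_pf (\<lambda>x y. h (b x y)) k xs"
  by (induction k arbitrary: xs) (simp_all add: assms alt_sum_hom[of h, OF assms(1,2)])

text \<open>
  The Clifford relation \<open>uw + wu = 2b(u,w)\<close>. For a skew-symmetric \<open>b\<close> the exchange of two neighbours
  would just change the sign. For a symmetric \<open>b\<close> the entry at the pair itself keeps its sign, and
  twice the cofactor of that entry remains.
\<close>

lemma list_pf_swap:
  assumes sym: "\<And>x y. b x y = b y x" and "length us + length ws = 2 * k"
  shows "list_pf b (Suc k) (us @ u # w # ws) + list_pf b (Suc k) (us @ w # u # ws)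
           = 2 * b u w * list_pf b k (us @ ws)"
  using assms(2)
proof (induction k arbitrary: us ws)
  case 0
  then show ?case by (simp add: sym[of w u])
next
  case (Suc k)
  show ?case
  proof (cases us)
    case Nil
    have "alt_sum (\<lambda>y ys. b u y * alt_sum (\<lambda>z zs. b w z * list_pf b k zs) ys) ws
        = alt_sum (\<lambda>y ys. alt_sum (\<lambda>z zs. b u y * (b w z * list_pf b k zs)) ys) ws"
      by (simp only: alt_sum_mult_left)
    also have "\<dots> = - alt_sum (\<lambda>y ys. alt_sum (\<lambda>z zs. b u z * (b w y * list_pf b k zs)) ys) ws"
      by (rule alt_sum_twice_antisym)
    also have "\<dots> = - alt_sum (\<lambda>y ys. b w y * alt_sum (\<lambda>z zs. b u z * list_pf b k zs) ys) ws"
      by (simp only: mult.left_commute[of "b u _"] alt_sum_mult_left)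
    finally have "alt_sum (\<lambda>y ys. b u y * alt_sum (\<lambda>z zs. b w z * list_pf b k zs) ys) ws
        = - alt_sum (\<lambda>y ys. b w y * alt_sum (\<lambda>z zs. b u z * list_pf b k zs) ys) ws" .
    then show ?thesis using Nil by (simp add: sym[of w u])
  next
    case (Cons a us')
    let ?f = "\<lambda>y ys. b a y * list_pf b (Suc k) ys"
    have expand: "list_pf b (Suc (Suc k)) (us @ p # q # ws) =
        alt_sum (\<lambda>y ys. ?f y (ys @ p # q # ws)) us'
        + (-1) ^ length us' * (?f p (us' @ q # ws) - ?f q (us' @ p # ws)
            + alt_sum (\<lambda>y ys. ?f y (us' @ p # q # ys)) ws)" for p q
      unfolding Cons append_Cons list_pf.simps(2)[of b "Suc k"] list.sel alt_sum_append alt_sum.simps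
      by (simp only: algebra_simps)
    have 1: "alt_sum (\<lambda>y ys. ?f y (ys @ u # w # ws)) us' + alt_sum (\<lambda>y ys. ?f y (ys @ w # u # ws)) us'
        = 2 * b u w * alt_sum (\<lambda>y ys. b a y * list_pf b k (ys @ ws)) us'"
      unfolding alt_sum_add[symmetric] alt_sum_mult_left[symmetric]
    proof (rule alt_sum_cong)
      fix vs y vs' assume "us' = vs @ y # vs'"
      then have "length (vs @ vs') + length ws = 2 * k" using Suc.prems Cons by simp
      from Suc.IH[OF this]
      show "b a y * list_pf b (Suc k) ((vs @ vs') @ u # w # ws) + b a y * list_pf b (Suc k) ((vs @ vs') @ w # u # ws)
          = 2 * b u w * (b a y * list_pf b k ((vs @ vs') @ ws))"
        by (simp only: distrib_left[symmetric]) (simp add: mult_ac)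
    qed
    have 2: "alt_sum (\<lambda>y ys. ?f y (us' @ u # w # ys)) ws + alt_sum (\<lambda>y ys. ?f y (us' @ w # u # ys)) ws
        = 2 * b u w * alt_sum (\<lambda>y ys. b a y * list_pf b k (us' @ ys)) ws"
      unfolding alt_sum_add[symmetric] alt_sum_mult_left[symmetric]
    proof (rule alt_sum_cong)
      fix vs y vs' assume "ws = vs @ y # vs'"
      then have "length us' + length (vs @ vs') = 2 * k" using Suc.prems Cons by simp
      from Suc.IH[OF this]
      show "b a y * list_pf b (Suc k) (us' @ u # w # vs @ vs') + b a y * list_pf b (Suc k) (us' @ w # u # vs @ vs')
          = 2 * b u w * (b a y * list_pf b k (us' @ vs @ vs'))"
        by (simp only: distrib_left[symmetric]) (simp add: mult_ac)
    qed
    have 3: "list_pf b (Suc k) (us @ ws) = alt_sum (\<lambda>y ys. b a y * list_pf b k (ys @ ws)) us'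
        + (-1) ^ length us' * alt_sum (\<lambda>y ys. b a y * list_pf b k (us' @ ys)) ws"
      unfolding Cons by (simp add: alt_sum_append)
    have "list_pf b (Suc (Suc k)) (us @ u # w # ws) + list_pf b (Suc (Suc k)) (us @ w # u # ws)
      = (alt_sum (\<lambda>y ys. ?f y (ys @ u # w # ws)) us' + alt_sum (\<lambda>y ys. ?f y (ys @ w # u # ws)) us')
       + (-1) ^ length us' * (alt_sum (\<lambda>y ys. ?f y (us' @ u # w # ys)) ws + alt_sum (\<lambda>y ys. ?f y (us' @ w # u # ys)) ws)"
      unfolding expand by (simp only: algebra_simps)
    also have "\<dots> = 2 * b u w * list_pf b (Suc k) (us @ ws)"
      unfolding 1 2 3 by (simp only: algebra_simps)
    finally show ?thesis .
  qed
qed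

text \<open>
  The two copies of \<open>u\<close> are brought together by exchanges of neighbours. Each exchange costs twice a
  shorter Pfaffian, hence a multiple of \<open>2 * d\<close>; and with the copies adjacent the Pfaffian vanishes,
  by the Clifford relation and \<open>b u u = 0\<close>.
\<close>

lemma list_pf_repeat_dvd:
  fixes b :: "'a \<Rightarrow> 'a \<Rightarrow> int"
  assumes sym: "\<And>x y. b x y = b y x" and null: "b u u = 0"
    and dvd: "\<And>xs. length xs = 2 * k \<Longrightarrow> set xs \<subseteq> C \<Longrightarrow> d dvd list_pf b k xs"
    and "set (us @ u # vs @ u # ws) \<subseteq> C" and "length (us @ u # vs @ u # ws) = 2 * Suc k"
  shows "2 * d dvd list_pf b (Suc k) (us @ u # vs @ u # ws)"
  using assms(4,5)
proof (induction vs arbitrary: us)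
  case Nil
  have "2 * list_pf b (Suc k) (us @ u # u # ws) = 0"
    using list_pf_swap[of b us ws k u u, OF sym] Nil null by (simp del: list_pf.simps)
  then show ?case by (simp del: list_pf.simps)
next
  case (Cons v vs)
  have IH: "2 * d dvd list_pf b (Suc k) (us @ v # u # vs @ u # ws)"
    using Cons.IH[of "us @ [v]"] Cons.prems by (simp del: list_pf.simps)
  have "d dvd list_pf b k (us @ vs @ u # ws)"
    by (rule dvd) (use Cons.prems in auto)
  then have "2 * d dvd 2 * b u v * list_pf b k (us @ vs @ u # ws)"
    by (simp add: mult_dvd_mono)
  moreover have "list_pf b (Suc k) (us @ u # v # vs @ u # ws) =
      2 * b u v * list_pf b k (us @ vs @ u # ws) - list_pf b (Suc k) (us @ v # u # vs @ u # ws)"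
    using list_pf_swap[of b us "vs @ u # ws" k u v, OF sym] Cons.prems by (simp del: list_pf.simps)
  ultimately show ?case using IH by (simp del: list_pf.simps)
qed

text \<open>
  A list of length \<open>2k > 2\<nu>\<close> over at most \<open>2\<nu>\<close> letters repeats a letter, so every step of the length
  beyond \<open>2\<nu>\<close> contributes a factor \<open>2\<close>. This is why \<open>g_tilde\<close> has integer coefficients.
\<close>

lemma list_pf_dvd:
  fixes b :: "'a \<Rightarrow> 'a \<Rightarrow> int"
  assumes sym: "\<And>x y. b x y = b y x" and null: "\<And>x. x \<in> C \<Longrightarrow> b x x = 0"
    and C: "finite C" "card C \<le> 2 * \<nu>"
  shows "length xs = 2 * k \<Longrightarrow> set xs \<subseteq> C \<Longrightarrow> 2 ^ (k - \<nu>) dvd list_pf b k xs"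
proof (induction k arbitrary: xs)
  case (Suc k)
  show ?case
  proof (cases "Suc k \<le> \<nu>")
    case False
    then have "card (set xs) < length xs"
      using card_mono[OF C(1) Suc.prems(2)] C(2) Suc.prems(1) by simp
    then have "\<not> distinct xs" using distinct_card by fastforce
    then obtain us u vs ws where xs: "xs = us @ [u] @ vs @ [u] @ ws"
      using not_distinct_decomp by blast
    have "2 * 2 ^ (k - \<nu>) dvd list_pf b (Suc k) (us @ u # vs @ u # ws)"
      by (rule list_pf_repeat_dvd[where C = C]) (use Suc xs sym null in auto)
    moreover have "(2::int) ^ (Suc k - \<nu>) = 2 * 2 ^ (k - \<nu>)"
      using False by (simp add: Suc_diff_le)
    ultimately show ?thesis using xs by (simp del: list_pf.simps)
  qed simp
qed simp

section \<open>Perfect matchings and the recursive Pfaffian\<close>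

lemma pfaffian_cong:
  assumes "\<And>i j. i < 2 * p \<Longrightarrow> j < 2 * p \<Longrightarrow> M i j = N i j"
  shows "pfaffian p M = pfaffian p N"
  unfolding pfaffian_def
proof (intro sum.cong refl arg_cong2[where f = "(*)"] prod.cong)
  fix \<sigma> k assume "\<sigma> \<in> matching_perms p" "k \<in> {..<p}"
  then have "\<sigma> permutes {..<2 * p}" "2 * k \<in> {..<2 * p}" "2 * k + 1 \<in> {..<2 * p}"
    by (auto simp: matching_perms_def)
  from permutes_in_image[OF this(1)] this(2,3)
  have "\<sigma> (2 * k) \<in> {..<2 * p}" "\<sigma> (2 * k + 1) \<in> {..<2 * p}" by blast+
  then show "M (\<sigma> (2 * k)) (\<sigma> (2 * k + 1)) = N (\<sigma> (2 * k)) (\<sigma> (2 * k + 1))"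
    by (simp add: assms)
qed

text \<open>
  A canonical matching permutation of \<open>2p + 2\<close> points starts with \<open>0\<close> and the partner \<open>Suc j\<close> of
  \<open>0\<close>; the remaining values form a canonical matching permutation \<open>s\<close> of \<open>2p\<close> points, renumbered
  past the two used values by \<open>skip j\<close>.
\<close>

definition first_pair :: "nat \<Rightarrow> (nat \<Rightarrow> nat) \<Rightarrow> nat \<Rightarrow> nat" where
  "first_pair j s = permutation_insert 0 0 (permutation_insert 0 j s)"

definition skip :: "nat \<Rightarrow> nat \<Rightarrow> nat" where
  "skip j i = Suc (if i < j then i else Suc i)"

lemma skip_less_iff: "skip j a < skip j c \<longleftrightarrow> a < c"
  by (auto simp: skip_def)

lemma first_pair_simps [simp]:
  "first_pair j s 0 = 0"
  "first_pair j s (Suc 0) = Suc j"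
  "first_pair j s (Suc (Suc i)) = skip j (s i)"
  by (simp_all add: first_pair_def permutation_insert_expand skip_def)

lemma first_pair_permutes:
  assumes "s permutes {..<2 * p}" and "j < 2 * p + 1"
  shows "first_pair j s permutes {..<2 * Suc p}"
proof -
  have "permutation_insert 0 j s permutes {0..<Suc (2 * p)}"
    by (rule permutation_insert_permutes) (use assms in \<open>auto simp: atLeast0LessThan\<close>)
  then have "permutation_insert 0 0 (permutation_insert 0 j s) permutes {0..<Suc (Suc (2 * p))}"
    by (rule permutation_insert_permutes) auto
  then show ?thesis by (simp add: first_pair_def atLeast0LessThan)
qed

lemma sign_first_pair:
  assumes "s permutes {..<2 * p}" and "j < 2 * p + 1"
  shows "sign (first_pair j s) = (-1) ^ j * sign s"
proof -
  have 1: "permutation_insert 0 j s permutes {0..<Suc (2 * p)}"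
    by (rule permutation_insert_permutes) (use assms in \<open>auto simp: atLeast0LessThan\<close>)
  have "of_int (sign (first_pair j s)) = (of_int (sign (permutation_insert 0 j s)) :: int)"
    unfolding first_pair_def using signof_permutation_insert[OF 1, of 0 0, where 'a = int] by simp
  also have "\<dots> = (-1) ^ j * of_int (sign s)"
    using signof_permutation_insert[of s "2 * p" 0 j, where 'a = int] assms
    by (simp add: atLeast0LessThan)
  finally show ?thesis by simp
qed

text \<open>
  The value \<open>0\<close> cannot be the second element of a pair, nor the first element of a later pair,
  because both exceed some other value.
\<close>

lemma matching_perms_0:
  assumes "\<sigma> \<in> matching_perms (Suc p)"
  shows "\<sigma> 0 = 0"
proof -
  have perm: "\<sigma> permutes {..<2 * Suc p}"
    and pair: "\<And>k. k < Suc p \<Longrightarrow> \<sigma> (2 * k) < \<sigma> (2 * k + 1)"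
    and mono: "\<And>k. k + 1 < Suc p \<Longrightarrow> \<sigma> (2 * k) < \<sigma> (2 * (k + 1))"
    using assms by (auto simp: matching_perms_def)
  have "0 \<in> \<sigma> ` {..<2 * Suc p}" using permutes_image[OF perm] by simp
  then obtain x where x: "x < 2 * Suc p" "\<sigma> x = 0" by force
  have "x = 0"
  proof (rule ccontr)
    assume "x \<noteq> 0"
    show False
    proof (cases "even x")
      case True
      then obtain k where "x = 2 * (k + 1)" using \<open>x \<noteq> 0\<close> by (metis add.commute evenE mult_0_right not0_implies_Suc plus_1_eq_Suc)
      then show False using mono[of k] x by simp
    next
      case False
      then obtain k where "x = 2 * k + 1" by (metis oddE)
      then show False using pair[of k] x by simp
    qed
  qed
  then show ?thesis using x by simp
qed

lemma matching_perms_first_pair_iff: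
  assumes "s permutes {..<2 * p}" and "j < 2 * p + 1"
  shows "first_pair j s \<in> matching_perms (Suc p) \<longleftrightarrow> s \<in> matching_perms p"
proof -
  have 1: "(\<forall>k<Suc p. first_pair j s (2 * k) < first_pair j s (2 * k + 1))
      \<longleftrightarrow> (\<forall>k<p. s (2 * k) < s (2 * k + 1))"
(is "?l = ?r")
  proof
    assume ?l
    show ?r
    proof (intro allI impI)
      fix k assume "k < p"
      then have "first_pair j s (2 * Suc k) < first_pair j s (2 * Suc k + 1)" using \<open>?l\<close> by blast
      then show "s (2 * k) < s (2 * k + 1)" by (simp add: skip_less_iff)
    qed
  next
    assume ?r
    show ?l
    proof (intro allI impI)
      fix k assume "k < Suc p"
      then show "first_pair j s (2 * k) < first_pair j s (2 * k + 1)"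
        using \<open>?r\<close> by (cases k) (auto simp: skip_less_iff)
    qed
  qed
  have 2: "(\<forall>k. k + 1 < Suc p \<longrightarrow> first_pair j s (2 * k) < first_pair j s (2 * (k + 1)))
      \<longleftrightarrow> (\<forall>k. k + 1 < p \<longrightarrow> s (2 * k) < s (2 * (k + 1)))" (is "?l = ?r")
  proof
    assume ?l
    show ?r
    proof (intro allI impI)
      fix k assume "k + 1 < p"
      then have "first_pair j s (2 * Suc k) < first_pair j s (2 * (Suc k + 1))"
        using \<open>?l\<close> by (metis Suc_eq_plus1 Suc_less_eq)
      then show "s (2 * k) < s (2 * (k + 1))" by (simp add: skip_less_iff)
    qed
  next
    assume ?r
    show ?l
    proof (intro allI impI)
      fix k assume k: "k + 1 < Suc p"
      show "first_pair j s (2 * k) < first_pair j s (2 * (k + 1))"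
      proof (cases k)
        case 0
        then show ?thesis by (simp add: numeral_2_eq_2 skip_def)
      next
        case (Suc k')
        then show ?thesis using \<open>?r\<close>[rule_format, of k'] k by (simp add: skip_less_iff)
      qed
    qed
  qed
  show ?thesis
    using 1 2 first_pair_permutes[OF assms] assms(1) unfolding matching_perms_def by simp
qed

lemma bij_betw_first_pair:
  "bij_betw (\<lambda>(j, s). first_pair j s) ({..<2 * p + 1} \<times> matching_perms p) (matching_perms (Suc p))"
  unfolding bij_betw_def
proof
  show "inj_on (\<lambda>(j, s). first_pair j s) ({..<2 * p + 1} \<times> matching_perms p)"
  proof (rule inj_onI; clarify)
    fix j s j' s'
    assume eq: "first_pair j s = first_pair j' s'"
    have "j = j'" using fun_cong[OF eq, of "Suc 0"] by simp
    moreover have "s i = s' i" for i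
      using fun_cong[OF eq, of "Suc (Suc i)"] skip_less_iff[of j "s i" "s' i"] skip_less_iff[of j "s' i" "s i"]
        \<open>j = j'\<close> by simp
    ultimately show "j = j' \<and> s = s'" by auto
  qed
  show "(\<lambda>(j, s). first_pair j s) ` ({..<2 * p + 1} \<times> matching_perms p) = matching_perms (Suc p)"
  proof (intro equalityI subsetI)
    fix \<sigma> assume "\<sigma> \<in> (\<lambda>(j, s). first_pair j s) ` ({..<2 * p + 1} \<times> matching_perms p)"
    then show "\<sigma> \<in> matching_perms (Suc p)"
      using matching_perms_first_pair_iff[of _ p]
      by (auto simp: matching_perms_def[of p])
  next
    fix \<sigma> assume \<sigma>: "\<sigma> \<in> matching_perms (Suc p)"
    then have "\<sigma> permutes {0..<Suc (Suc (2 * p))}" "\<sigma> 0 = 0"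
      by (auto simp: matching_perms_def atLeast0LessThan matching_perms_0[OF \<sigma>])
    then obtain \<tau> where \<tau>: "\<sigma> = permutation_insert 0 0 \<tau>" "\<tau> permutes {0..<Suc (2 * p)}"
      using permutation_fix[of 0 "Suc (2 * p)" 0] by blast
    have j: "\<tau> 0 < Suc (2 * p)" using permutes_in_image[OF \<tau>(2), of 0] by simp
    then obtain s where s: "\<tau> = permutation_insert 0 (\<tau> 0) s" "s permutes {0..<2 * p}"
      using permutation_fix[of 0 "2 * p" "\<tau> 0"] \<tau>(2) by blast
    have eq: "\<sigma> = first_pair (\<tau> 0) s" unfolding first_pair_def using \<tau>(1) s(1) by simp
    moreover have "s \<in> matching_perms p"
      using matching_perms_first_pair_iff[of s p "\<tau> 0"] \<sigma> eq s(2) j by (simp add: atLeast0LessThan)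
    ultimately show "\<sigma> \<in> (\<lambda>(j, s). first_pair j s) ` ({..<2 * p + 1} \<times> matching_perms p)"
      using j by (auto intro!: image_eqI[of _ _ "(\<tau> 0, s)"])
  qed
qed

lemma pfaffian_Suc:
  "pfaffian (Suc p) M =
    (\<Sum>j<2 * p + 1. (-1) ^ j * (M 0 (Suc j) * pfaffian p (\<lambda>a c. M (skip j a) (skip j c))))"
proof -
  let ?t = "\<lambda>\<sigma>. of_int (sign \<sigma>) * (\<Prod>k<Suc p. M (\<sigma> (2 * k)) (\<sigma> (2 * k + 1)))"
  have "pfaffian (Suc p) M = (\<Sum>(j, s)\<in>{..<2 * p + 1} \<times> matching_perms p. ?t (first_pair j s))"
    unfolding pfaffian_def sum.reindex_bij_betw[OF bij_betw_first_pair, symmetric]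
    by (simp only: case_prod_unfold)
  also have "\<dots> = (\<Sum>j<2 * p + 1. \<Sum>s\<in>matching_perms p. ?t (first_pair j s))"
    by (simp only: sum.cartesian_product)
  also have "\<dots> = (\<Sum>j<2 * p + 1. (-1) ^ j * (M 0 (Suc j) * pfaffian p (\<lambda>a c. M (skip j a) (skip j c))))"
    unfolding pfaffian_def sum_distrib_left
  proof (intro sum.cong refl)
    fix j s assume "j \<in> {..<2 * p + 1}" "s \<in> matching_perms p"
    then have "s permutes {..<2 * p}" "j < 2 * p + 1" by (auto simp: matching_perms_def)
    then have "sign (first_pair j s) = (-1) ^ j * sign s" by (rule sign_first_pair)
    then show "?t (first_pair j s) = (-1) ^ j * (M 0 (Suc j) *
        (of_int (sign s) * (\<Prod>k<p. M (skip j (s (2 * k))) (skip j (s (2 * k + 1))))))"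
      by (simp add: prod.lessThan_Suc_shift mult_ac del: prod.lessThan_Suc)
  qed
  finally show ?thesis .
qed

lemma pfaffian_conv_list_pf:
  "length xs = 2 * p \<Longrightarrow> pfaffian p (\<lambda>i j. M (xs ! i) (xs ! j)) = list_pf M p xs"
proof (induction p arbitrary: xs)
  case 0
  have "matching_perms 0 = {id}" by (auto simp: matching_perms_def)
  then show ?case by (simp add: pfaffian_def)
next
  case (Suc p)
  then obtain u us where xs: "xs = u # us" by (cases xs) auto
  have len: "length us = 2 * p + 1" using Suc.prems xs by simp
  show ?case
    unfolding pfaffian_Suc xs list_pf.simps alt_sum_conv_sum list.sel len
  proof (intro sum.cong refl arg_cong2[where f = "(*)"])
    fix j assume "j \<in> {..<2 * p + 1}"
    then have j: "j < length us" using len by simp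
    let ?ys = "take j us @ drop (Suc j) us"
    have nth: "(u # us) ! skip j i = ?ys ! i" if "i < 2 * p" for i
      using that j len by (auto simp: skip_def nth_append min_def)
    have "pfaffian p (\<lambda>a c. M ((u # us) ! skip j a) ((u # us) ! skip j c))
        = pfaffian p (\<lambda>a c. M (?ys ! a) (?ys ! c))"
      by (rule pfaffian_cong) (simp add: nth)
    also have "\<dots> = list_pf M p ?ys" by (rule Suc.IH) (use j len in auto)
    finally show "pfaffian p (\<lambda>a c. M ((u # us) ! skip j a) ((u # us) ! skip j c)) = list_pf M p ?ys" .
  qed simp_all
qed

section \<open>Evaluation and multilinear parts of polynomials\<close>

text \<open>
  The evaluation of a polynomial at a tuple of vectors and the evaluation of one of its multilinear
  parts are both linear in the polynomial. Treating them as linear functionals given by their values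
  on monomials reduces their behaviour on products to a statement about monomials.
\<close>

definition lin :: "(monom \<Rightarrow> complex) \<Rightarrow> cpoly \<Rightarrow> complex" where
  "lin c f = (\<Sum>s\<in>Poly_Mapping.keys f. Poly_Mapping.lookup f s * c s)"

lemma lin_superset:
  assumes "finite K" and "Poly_Mapping.keys f \<subseteq> K"
  shows "lin c f = (\<Sum>s\<in>K. Poly_Mapping.lookup f s * c s)"
  unfolding lin_def using assms
  by (intro sum.mono_neutral_left) (auto simp: in_keys_iff)

lemma lin_zero [simp]: "lin c 0 = 0"
  by (simp add: lin_def)

lemma lin_single [simp]: "lin c (Poly_Mapping.single s a) = a * c s"
  by (simp add: lin_def)

lemma lin_add: "lin c (f + g) = lin c f + lin c g"
proof -
  let ?K = "Poly_Mapping.keys f \<union> Poly_Mapping.keys g"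
  have "Poly_Mapping.keys (f + g) \<subseteq> ?K" by (rule keys_add)
  then show ?thesis
    by (subst (1 2 3) lin_superset[of ?K])
      (auto simp: lookup_add algebra_simps sum.distrib)
qed

lemma lin_diff: "lin c (f - g) = lin c f - lin c g"
  using lin_add[of c "f - g" g] by simp

lemma lin_sum: "lin c (sum f X) = (\<Sum>x\<in>X. lin c (f x))"
  by (induction X rule: infinite_finite_induct) (simp_all add: lin_add)

lemma sum_single_keys: "(\<Sum>s\<in>Poly_Mapping.keys f. Poly_Mapping.single s (Poly_Mapping.lookup f s)) = f"
  by (rule poly_mapping_eqI) (auto simp: lookup_sum lookup_single when_def in_keys_iff)

lemma lin_mult:
  "lin c (f * g) = (\<Sum>s\<in>Poly_Mapping.keys f. \<Sum>t\<in>Poly_Mapping.keys g.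
     Poly_Mapping.lookup f s * Poly_Mapping.lookup g t * c (s + t))"
proof -
  have "lin c (f * g) = lin c
      ((\<Sum>s\<in>Poly_Mapping.keys f. Poly_Mapping.single s (Poly_Mapping.lookup f s)) *
       (\<Sum>t\<in>Poly_Mapping.keys g. Poly_Mapping.single t (Poly_Mapping.lookup g t)))"
    by (simp only: sum_single_keys)
  then show ?thesis by (simp add: sum_product lin_sum mult_single)
qed

lemma lin_mult_hom:
  assumes "\<And>s t. c (s + t) = a s * b t"
  shows "lin c (f * g) = lin a f * lin b g"
  unfolding lin_mult assms by (simp add: lin_def sum_product mult_ac)

definition ev :: "(nat \<Rightarrow> complex vec) \<Rightarrow> monom \<Rightarrow> complex" where
  "ev v s = (\<Prod>(i, k)\<in>Poly_Mapping.keys s. (v i $ k) ^ Poly_Mapping.lookup s (i, k))"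

lemma poly_at_conv_lin: "poly_at f v = lin (ev v) f"
  by (simp add: poly_at_def lin_def ev_def)

lemma ev_superset:
  assumes "finite K" and "Poly_Mapping.keys s \<subseteq> K"
  shows "ev v s = (\<Prod>(i, k)\<in>K. (v i $ k) ^ Poly_Mapping.lookup s (i, k))"
  unfolding ev_def using assms
  by (intro prod.mono_neutral_left) (auto simp: in_keys_iff)

lemma ev_zero [simp]: "ev v 0 = 1"
  by (simp add: ev_def)

lemma keys_add_monom: "Poly_Mapping.keys (s + t :: monom) = Poly_Mapping.keys s \<union> Poly_Mapping.keys t"
  by (auto simp: in_keys_iff lookup_add)

lemma ev_add: "ev v (s + t) = ev v s * ev v t"
  by (subst (1 2 3) ev_superset[of "Poly_Mapping.keys s \<union> Poly_Mapping.keys t"])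
    (auto simp: keys_add_monom lookup_add power_add prod.distrib[symmetric] intro!: prod.cong)

lemma poly_at_zero [simp]: "poly_at 0 v = 0"
  by (simp add: poly_at_conv_lin)

lemma poly_at_one [simp]: "poly_at 1 v = 1"
  by (simp add: poly_at_conv_lin flip: single_one)

lemma poly_at_add: "poly_at (f + g) v = poly_at f v + poly_at g v"
  by (simp add: poly_at_conv_lin lin_add)

lemma poly_at_diff: "poly_at (f - g) v = poly_at f v - poly_at g v"
  by (simp add: poly_at_conv_lin lin_diff)

lemma poly_at_mult: "poly_at (f * g) v = poly_at f v * poly_at g v"
  unfolding poly_at_conv_lin by (rule lin_mult_hom) (rule ev_add)

lemma poly_at_sum: "poly_at (sum f X) v = (\<Sum>x\<in>X. poly_at (f x) v)"
  by (simp add: poly_at_conv_lin lin_sum)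

lemma poly_at_cconst: "poly_at (cconst c) v = c"
  by (simp add: poly_at_conv_lin cconst_def)

lemma poly_at_cvar: "poly_at (cvar i k) v = v i $ k"
  by (simp add: poly_at_conv_lin cvar_def ev_def)

definition vdeg :: "nat \<Rightarrow> monom \<Rightarrow> nat \<Rightarrow> nat" where
  "vdeg n s i = (\<Sum>k<n. Poly_Mapping.lookup s (i, k))"

definition ml_monom :: "nat \<Rightarrow> nat \<Rightarrow> nat set \<Rightarrow> monom \<Rightarrow> bool" where
  "ml_monom n m T s \<longleftrightarrow> Poly_Mapping.keys s \<subseteq> {..<m} \<times> {..<n} \<and>
     (\<forall>i<m. vdeg n s i = (if i \<in> T then 1 else 0))"

lemma vdeg_add: "vdeg n (s + t) i = vdeg n s i + vdeg n t i"
  by (simp add: vdeg_def lookup_add sum.distrib)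

lemma ml_monom_addI:
  assumes "ml_monom n m U s" "ml_monom n m W t" "U \<inter> W = {}"
  shows "ml_monom n m (U \<union> W) (s + t)"
  using assms by (auto simp: ml_monom_def keys_add_monom vdeg_add)

lemma ml_monom_unique:
  assumes "ml_monom n m U s" "ml_monom n m W s" "U \<subseteq> {..<m}" "W \<subseteq> {..<m}"
  shows "U = W"
proof -
  have "i \<in> U \<longleftrightarrow> i \<in> W" if "i < m" for i
    using assms(1,2) that unfolding ml_monom_def by (metis zero_neq_one)
  then show ?thesis using assms(3,4) by auto
qed

lemma ml_monom_add_split:
  assumes T: "T \<subseteq> {..<m}" and st: "ml_monom n m T (s + t)"
  obtains U where "U \<subseteq> T" "ml_monom n m U s" "ml_monom n m (T - U) t"
proof
  let ?U = "{i \<in> T. vdeg n s i = 1}"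
  have *: "vdeg n s i + vdeg n t i = (if i \<in> T then 1 else 0)" if "i < m" for i
    using st that by (simp add: ml_monom_def vdeg_add)
  show "?U \<subseteq> T" by auto
  show "ml_monom n m ?U s" "ml_monom n m (T - ?U) t"
    using st * by (fastforce simp: ml_monom_def keys_add_monom add_is_1 split: if_splits)+
qed

lemma ml_monom_add_sum:
  assumes T: "T \<subseteq> {..<m}"
  shows "(if ml_monom n m T (s + t) then a * c else 0 :: complex) =
    (\<Sum>U\<in>Pow T. (if ml_monom n m U s then a else 0) * (if ml_monom n m (T - U) t then c else 0))"
proof (cases "ml_monom n m T (s + t)")
  case True
  then obtain V where V: "V \<subseteq> T" "ml_monom n m V s" "ml_monom n m (T - V) t"
    using ml_monom_add_split[OF T] by blast
  have fin: "finite (Pow T)" using T finite_subset by auto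
  have "(\<Sum>U\<in>Pow T. (if ml_monom n m U s then a else 0) * (if ml_monom n m (T - U) t then c else 0))
      = (\<Sum>U\<in>{V}. (if ml_monom n m U s then a else 0) * (if ml_monom n m (T - U) t then c else 0))"
  proof (rule sum.mono_neutral_right)
    have "U = V" if "U \<subseteq> T" "ml_monom n m U s" for U
      by (rule ml_monom_unique[OF that(2) V(2)]) (use that V(1) T in blast)+
    then show "\<forall>U\<in>Pow T - {V}. (if ml_monom n m U s then a else 0) * (if ml_monom n m (T - U) t then c else 0) = 0"
      by auto
  qed (use V fin in auto)
  then show ?thesis using True V by simp
next
  case False
  have "(if ml_monom n m U s then a else 0) * (if ml_monom n m (T - U) t then c else 0) = 0"
    if "U \<subseteq> T" for U
    using ml_monom_addI[of n m U s "T - U" t] that False by (auto simp: Un_absorb1)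
  then show ?thesis using False by (simp add: sum.neutral)
qed

text \<open>
  The value at \<open>v\<close> of the part of \<open>f\<close> that is linear in each \<open>v\<^sub>i\<close>, \<open>i \<in> T\<close>, and free of the other
  vectors.
\<close>

definition mlpart :: "nat \<Rightarrow> nat \<Rightarrow> nat set \<Rightarrow> cpoly \<Rightarrow> (nat \<Rightarrow> complex vec) \<Rightarrow> complex" where
  "mlpart n m T f v = lin (\<lambda>s. if ml_monom n m T s then ev v s else 0) f"

lemma mlpart_diff: "mlpart n m T (f - g) v = mlpart n m T f v - mlpart n m T g v"
  by (simp add: mlpart_def lin_diff)

lemma mlpart_one:
  assumes "i \<in> T" "i < m"
  shows "mlpart n m T 1 v = 0"
  using assms by (auto simp: mlpart_def ml_monom_def vdeg_def simp flip: single_one)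

text \<open>
  A product of monomials is multilinear in \<open>T\<close> iff the two factors are multilinear in complementary
  subsets of \<open>T\<close>.
\<close>

lemma mlpart_mult:
  assumes T: "T \<subseteq> {..<m}"
  shows "mlpart n m T (f * g) v = (\<Sum>U\<in>Pow T. mlpart n m U f v * mlpart n m (T - U) g v)"
proof -
  let ?c = "\<lambda>U s. if ml_monom n m U s then ev v s else 0"
  let ?h = "\<lambda>s t U. Poly_Mapping.lookup f s * Poly_Mapping.lookup g t * (?c U s * ?c (T - U) t)"
  have "mlpart n m T (f * g) v = (\<Sum>s\<in>Poly_Mapping.keys f. \<Sum>t\<in>Poly_Mapping.keys g. \<Sum>U\<in>Pow T. ?h s t U)"
    unfolding mlpart_def lin_mult ev_add ml_monom_add_sum[OF T] sum_distrib_left ..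
  also have "\<dots> = (\<Sum>s\<in>Poly_Mapping.keys f. \<Sum>U\<in>Pow T. \<Sum>t\<in>Poly_Mapping.keys g. ?h s t U)"
    by (intro sum.cong refl sum.swap)
  also have "\<dots> = (\<Sum>U\<in>Pow T. \<Sum>s\<in>Poly_Mapping.keys f. \<Sum>t\<in>Poly_Mapping.keys g. ?h s t U)"
    by (rule sum.swap)
  also have "\<dots> = (\<Sum>U\<in>Pow T. mlpart n m U f v * mlpart n m (T - U) g v)"
    unfolding mlpart_def lin_def sum_product by (intro sum.cong refl) (simp only: mult_ac)
  finally show ?thesis .
qed

lemma monom_degree_conv_vdeg:
  assumes "Poly_Mapping.keys s \<subseteq> {..<m} \<times> {..<n}"
  shows "monom_degree s = (\<Sum>i<m. vdeg n s i)"
proof -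
  have "monom_degree s = (\<Sum>a\<in>{..<m} \<times> {..<n}. Poly_Mapping.lookup s a)"
    unfolding monom_degree_def using assms by (intro sum.mono_neutral_left) (auto simp: in_keys_iff)
  then show ?thesis by (simp add: vdeg_def sum.cartesian_product case_prod_unfold)
qed

lemma monom_degree_ml_monom: "ml_monom n m {..<m} s \<Longrightarrow> monom_degree s = m"
  unfolding ml_monom_def by (subst monom_degree_conv_vdeg) auto

lemma mlpart_low_degree:
  assumes "total_degree f < m"
  shows "mlpart n m {..<m} f v = 0"
proof -
  have "\<not> ml_monom n m {..<m} s" if "s \<in> Poly_Mapping.keys f" for s
  proof -
    have "monom_degree s \<le> total_degree f"
      unfolding total_degree_def using that by (intro Max_ge) auto
    then show ?thesis using assms monom_degree_ml_monom by fastforce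
  qed
  then show ?thesis by (simp add: mlpart_def lin_def sum.neutral)
qed

lemma ml_monom_lookup_eq_0:
  assumes "ml_monom n m T s" "i \<notin> T" "i < m" "k < n"
  shows "Poly_Mapping.lookup s (i, k) = 0"
  using assms by (auto simp: ml_monom_def vdeg_def)

lemma ml_monom_ev_cong:
  assumes "ml_monom n m T s" and "\<And>i. i \<in> T \<Longrightarrow> v i = w i"
  shows "ev v s = ev w s"
  unfolding ev_def
proof (intro prod.cong refl, clarify)
  fix i k assume ik: "(i, k) \<in> Poly_Mapping.keys s"
  then have "i < m" "k < n" using assms(1) by (auto simp: ml_monom_def)
  then have "i \<in> T" using ml_monom_lookup_eq_0[OF assms(1), of i k] ik by (auto simp: in_keys_iff)
  then show "(v i $ k) ^ Poly_Mapping.lookup s (i, k) = (w i $ k) ^ Poly_Mapping.lookup s (i, k)"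
    by (simp add: assms(2))
qed

lemma mlpart_cong:
  assumes "\<And>i. i \<in> T \<Longrightarrow> v i = w i"
  shows "mlpart n m T f v = mlpart n m T f w"
proof -
  have "(\<lambda>s. if ml_monom n m T s then ev v s else 0) = (\<lambda>s. if ml_monom n m T s then ev w s else 0)"
    using ml_monom_ev_cong[OF _ assms, of n m T] by (simp add: fun_eq_iff)
  then show ?thesis by (simp add: mlpart_def)
qed

lemma ml_monom_coordinate:
  assumes s: "ml_monom n m T s" and i: "i \<in> T" "i < m"
  shows "\<exists>k<n. \<forall>l<n. Poly_Mapping.lookup s (i, l) = (if l = k then 1 else 0)"
proof -
  have "(\<Sum>k<n. Poly_Mapping.lookup s (i, k)) = 1"
    using s i by (simp add: ml_monom_def vdeg_def)
  then obtain k where "k < n" "Poly_Mapping.lookup s (i, k) = 1"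
      "\<And>l. l < n \<Longrightarrow> l \<noteq> k \<Longrightarrow> Poly_Mapping.lookup s (i, l) = 0"
    by (subst (asm) sum_eq_1_iff) auto
  then show ?thesis by (intro exI[of _ k]) auto
qed

lemma ml_monom_ev_linear:
  assumes s: "ml_monom n m T s" and i: "i \<in> T" "i < m"
  shows "\<exists>k<n. \<exists>c. \<forall>u. ev (v(i := u)) s = u $ k * c"
proof -
  obtain k where k: "k < n" "\<And>l. l < n \<Longrightarrow> Poly_Mapping.lookup s (i, l) = (if l = k then 1 else 0)"
    using ml_monom_coordinate[OF s i] by blast
  have ik: "(i, k) \<in> Poly_Mapping.keys s" "Poly_Mapping.lookup s (i, k) = 1"
    using k by (auto simp: in_keys_iff)
  let ?K = "Poly_Mapping.keys s - {(i, k)}"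
  let ?g = "\<lambda>v (j, l). (v j $ l) ^ Poly_Mapping.lookup s (j, l)"
  have "ev (v(i := u)) s = u $ k * (\<Prod>a\<in>?K. ?g v a)" for u
  proof -
    have "ev (v(i := u)) s = u $ k * (\<Prod>a\<in>?K. ?g (v(i := u)) a)"
      unfolding ev_def using ik by (subst prod.remove[OF finite_keys ik(1)]) simp
    also have "(\<Prod>a\<in>?K. ?g (v(i := u)) a) = (\<Prod>a\<in>?K. ?g v a)"
    proof (intro prod.cong refl)
      fix a assume a: "a \<in> ?K"
      obtain j l where jl: "a = (j, l)" by (cases a)
      have "l < n" using s a jl by (auto simp: ml_monom_def)
      then have "j \<noteq> i" using k(2)[of l] a jl by (auto simp: in_keys_iff split: if_splits)
      then show "?g (v(i := u)) a = ?g v a" by (simp add: jl)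
    qed
    finally show ?thesis .
  qed
  then show ?thesis using k(1) by blast
qed

lemma mlpart_linear:
  assumes i: "i \<in> T" "i < m" and uw: "u \<in> carrier_vec n" "w \<in> carrier_vec n"
  shows "mlpart n m T f (v(i := a \<cdot>\<^sub>v u + b \<cdot>\<^sub>v w)) =
    a * mlpart n m T f (v(i := u)) + b * mlpart n m T f (v(i := w))"
proof -
  have *: "ev (v(i := a \<cdot>\<^sub>v u + b \<cdot>\<^sub>v w)) s = a * ev (v(i := u)) s + b * ev (v(i := w)) s"
    if s: "ml_monom n m T s" for s
  proof -
    obtain k c where "k < n" "\<And>u. ev (v(i := u)) s = u $ k * c"
      using ml_monom_ev_linear[OF s i, of v] by blast
    then show ?thesis using uw by (simp add: algebra_simps)
  qed
  show ?thesis
    unfolding mlpart_def lin_def sum_distrib_left sum.distrib[symmetric]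
    by (intro sum.cong refl) (simp add: * algebra_simps)
qed

lemma mlpart_add:
  assumes "i \<in> T" "i < m" "u \<in> carrier_vec n" "w \<in> carrier_vec n"
  shows "mlpart n m T f (v(i := u + w)) = mlpart n m T f (v(i := u)) + mlpart n m T f (v(i := w))"
  using mlpart_linear[OF assms, of f v 1 1] by simp

lemma mlpart_Ints:
  assumes f: "\<And>s. Poly_Mapping.lookup f s \<in> \<int>" and v: "\<And>i k. i < m \<Longrightarrow> k < n \<Longrightarrow> v i $ k \<in> \<int>"
  shows "mlpart n m T f v \<in> \<int>"
  unfolding mlpart_def lin_def
proof (intro Ints_sum Ints_mult f)
  fix s
  show "(if ml_monom n m T s then ev v s else 0) \<in> \<int>"
  proof (cases "ml_monom n m T s")
    case True
    then have "ev v s \<in> \<int>" unfolding ev_def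
      by (intro Ints_prod) (auto simp: ml_monom_def intro!: Ints_power v)
    then show ?thesis by simp
  qed simp
qed

lemma digits_unique:
  fixes N :: nat
  assumes "(\<Sum>i<m. N ^ i * d i) = (\<Sum>i<m. N ^ i * e i)"
    and "\<And>i. i < m \<Longrightarrow> d i < N" "\<And>i. i < m \<Longrightarrow> e i < N" "i < m"
  shows "d i = e i"
  using assms
proof (induction m arbitrary: d e i)
  case (Suc m)
  have split: "(\<Sum>i<Suc m. N ^ i * d i) = d 0 + N * (\<Sum>i<m. N ^ i * d (Suc i))" for d
    by (simp add: sum.lessThan_Suc_shift sum_distrib_left mult_ac del: sum.lessThan_Suc)
  have eq: "d 0 + N * (\<Sum>i<m. N ^ i * d (Suc i)) = e 0 + N * (\<Sum>i<m. N ^ i * e (Suc i))"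
    using Suc.prems(1) unfolding split .
  have "d 0 < N" "e 0 < N" using Suc.prems by auto
  then have 0: "d 0 = e 0" using arg_cong[OF eq, of "\<lambda>x. x mod N"] by simp
  have "(\<Sum>i<m. N ^ i * d (Suc i)) = (\<Sum>i<m. N ^ i * e (Suc i))"
    using eq 0 \<open>d 0 < N\<close> by simp
  from Suc.IH[OF this] Suc.prems have "d (Suc j) = e (Suc j)" if "j < m" for j
    using that by auto
  then show ?case using 0 Suc.prems(4) by (cases i) auto
qed simp

lemma ev_scale:
  assumes s: "Poly_Mapping.keys s \<subseteq> {..<m} \<times> {..<n}" and v: "\<And>i. i < m \<Longrightarrow> v i \<in> carrier_vec n"
  shows "ev (\<lambda>i. z ^ e i \<cdot>\<^sub>v v i) s = z ^ (\<Sum>i<m. e i * vdeg n s i) * ev v s"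
proof -
  have "ev (\<lambda>i. z ^ e i \<cdot>\<^sub>v v i) s
      = (\<Prod>(i, k)\<in>{..<m} \<times> {..<n}. (z ^ (e i * Poly_Mapping.lookup s (i, k))) * (v i $ k) ^ Poly_Mapping.lookup s (i, k))"
    unfolding ev_superset[OF finite_cartesian_product[OF finite_lessThan finite_lessThan] s]
  proof (intro prod.cong refl)
    fix a assume a: "a \<in> {..<m} \<times> {..<n}"
    obtain i k where ik: "a = (i, k)" by (cases a)
    have "(z ^ e i \<cdot>\<^sub>v v i) $ k = z ^ e i * v i $ k" using v[of i] a ik by simp
    then show "(case a of (i, k) \<Rightarrow> ((z ^ e i \<cdot>\<^sub>v v i) $ k) ^ Poly_Mapping.lookup s (i, k)) =
       (case a of (i, k) \<Rightarrow> z ^ (e i * Poly_Mapping.lookup s (i, k)) * (v i $ k) ^ Poly_Mapping.lookup s (i, k))"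
      by (simp add: ik power_mult_distrib power_mult)
  qed
  also have "\<dots> = (\<Prod>i<m. \<Prod>k<n. z ^ (e i * Poly_Mapping.lookup s (i, k))) * ev v s"
    unfolding ev_superset[OF finite_cartesian_product[OF finite_lessThan finite_lessThan] s]
      prod.cartesian_product
    by (simp only: case_prod_unfold prod.distrib)
  also have "(\<Prod>i<m. \<Prod>k<n. z ^ (e i * Poly_Mapping.lookup s (i, k))) = z ^ (\<Sum>i<m. e i * vdeg n s i)"
    by (simp add: power_sum vdeg_def sum_distrib_left)
  finally show ?thesis .
qed

text \<open>
  Scaling the vectors independently commutes with \<open>A\<close>, so the multihomogeneous parts of an invariant
  are invariant. To extract one of them with a polynomial in a single variable \<open>z\<close>, the \<open>i\<close>-th
  vector is scaled by \<open>z ^ (N ^ i)\<close> with \<open>N\<close> larger than all degrees; the exponent of \<open>z\<close> then has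
  the multidegree as its digits in base \<open>N\<close>.
\<close>

lemma mlpart_invariant:
  assumes f: "f \<in> invariants n m" and A: "A \<in> orth_group n" and T: "T \<subseteq> {..<m}"
    and v: "\<And>i. i < m \<Longrightarrow> v i \<in> carrier_vec n"
  shows "mlpart n m T f (\<lambda>i. A *\<^sub>v v i) = mlpart n m T f v"
proof -
  \<comment> \<open>A bound for all multidegrees that also exceeds the digits 0 and 1.\<close>
  define N where "N = 2 + (\<Sum>s\<in>Poly_Mapping.keys f. monom_degree s)"
  define wt where "wt s = (\<Sum>i<m. N ^ i * vdeg n s i)" for s
  define wT where "wT = (\<Sum>i<m. N ^ i * (if i \<in> T then 1 else 0))"
  have box: "Poly_Mapping.keys s \<subseteq> {..<m} \<times> {..<n}" if "s \<in> Poly_Mapping.keys f" for s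
    using f that by (auto simp: invariants_def R_def)
  have A': "A \<in> carrier_mat n n" using A by (simp add: orth_group_def)
  have Av: "A *\<^sub>v v i \<in> carrier_vec n" if "i < m" for i using A' v[OF that] by simp
  have wt_iff: "wt s = wT \<longleftrightarrow> ml_monom n m T s" if s: "s \<in> Poly_Mapping.keys f" for s
  proof
    assume eq: "wt s = wT"
    have "vdeg n s i < N" if "i < m" for i
    proof -
      have "vdeg n s i \<le> monom_degree s"
        unfolding monom_degree_conv_vdeg[OF box[OF s]] using that by (intro member_le_sum) auto
      also have "\<dots> \<le> (\<Sum>s\<in>Poly_Mapping.keys f. monom_degree s)"
        using s by (intro member_le_sum) auto
      finally show ?thesis by (simp add: N_def)
    qed
    then have "vdeg n s i = (if i \<in> T then 1 else 0)" if "i < m" for i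
      using digits_unique[OF eq[unfolded wt_def wT_def] _ _ that] by (auto simp: N_def)
    then show "ml_monom n m T s" using box[OF s] by (simp add: ml_monom_def)
  next
    assume "ml_monom n m T s"
    then show "wt s = wT" unfolding wt_def wT_def ml_monom_def by (intro sum.cong) auto
  qed
  define P where "P u = (\<Sum>s\<in>Poly_Mapping.keys f. monom (Poly_Mapping.lookup f s * ev u s) (wt s))" for u
  have poly_P: "poly (P u) z = poly_at f (\<lambda>i. z ^ (N ^ i) \<cdot>\<^sub>v u i)"
    if "\<And>i. i < m \<Longrightarrow> u i \<in> carrier_vec n" for u z
    unfolding P_def poly_sum poly_monom poly_at_conv_lin lin_def
    by (intro sum.cong refl) (simp add: ev_scale[OF box that] wt_def)
  have coeff_P: "coeff (P u) wT = mlpart n m T f u" for u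
    unfolding P_def coeff_sum coeff_monom mlpart_def lin_def
    by (intro sum.cong refl) (simp add: wt_iff)
  have "poly (P (\<lambda>i. A *\<^sub>v v i)) z = poly (P v) z" for z
  proof -
    let ?u = "\<lambda>i. z ^ (N ^ i) \<cdot>\<^sub>v v i"
    have "poly_at f (\<lambda>i. A *\<^sub>v ?u i) = poly_at f ?u"
      using f A v by (auto simp: invariants_def)
    moreover have "poly_at f (\<lambda>i. A *\<^sub>v ?u i) = poly_at f (\<lambda>i. z ^ (N ^ i) \<cdot>\<^sub>v (A *\<^sub>v v i))"
      unfolding poly_at_conv_lin lin_def
    proof (intro sum.cong refl arg_cong2[where f = "(*)"])
      fix s assume "s \<in> Poly_Mapping.keys f"
      from box[OF this] show "ev (\<lambda>i. A *\<^sub>v ?u i) s = ev (\<lambda>i. z ^ (N ^ i) \<cdot>\<^sub>v (A *\<^sub>v v i)) s"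
        unfolding ev_def using mult_mat_vec[OF A' v] by (intro prod.cong) auto
    qed
    ultimately show ?thesis using v Av by (simp add: poly_P)
  qed
  then have "P (\<lambda>i. A *\<^sub>v v i) = P v" by (intro poly_ext) simp
  then show ?thesis using coeff_P by metis
qed

section \<open>Parity of multilinear invariants\<close>

text \<open>
  In this numbering \<open>e n (2 * r)\<close> and \<open>e n (2 * r + 1)\<close> span the \<open>r\<close>-th hyperbolic plane.
\<close>

abbreviation e :: "nat \<Rightarrow> nat \<Rightarrow> complex vec" where
  "e n k \<equiv> unit_vec n k"

lemma mat_eq_one:
  assumes M: "M \<in> carrier_mat n n" and "\<And>v. v \<in> carrier_vec n \<Longrightarrow> M *\<^sub>v v = (v :: complex vec)"
  shows "M = 1\<^sub>m n"
proof (rule eq_matI)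
  fix i j assume ij: "i < dim_row (1\<^sub>m n)" "j < dim_col (1\<^sub>m n)"
  have "(M *\<^sub>v e n j) $ i = M $$ (i, j)"
    using M ij by (simp add: scalar_prod_right_unit)
  then have "M $$ (i, j) = e n j $ i" using assms(2)[of "e n j"] by simp
  then show "M $$ (i, j) = 1\<^sub>m n $$ (i, j)" using ij by simp
qed (use M in auto)

lemma orth_groupI:
  assumes A: "A \<in> carrier_mat n n" and A': "A' \<in> carrier_mat n n"
    and inv: "\<And>v. v \<in> carrier_vec n \<Longrightarrow> A *\<^sub>v (A' *\<^sub>v v) = v" "\<And>v. v \<in> carrier_vec n \<Longrightarrow> A' *\<^sub>v (A *\<^sub>v v) = v"
    and quad: "\<And>v. v \<in> carrier_vec n \<Longrightarrow> quad n (A *\<^sub>v v) = quad n v"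
  shows "A \<in> orth_group n"
proof -
  have "A * A' = 1\<^sub>m n" "A' * A = 1\<^sub>m n"
    by (rule mat_eq_one; use A A' inv in \<open>simp add: assoc_mult_mat_vec\<close>)+
  then have "invertible_mat A"
    using A A' unfolding invertible_mat_def inverts_mat_def square_mat.simps by auto
  then show ?thesis using A quad by (simp add: orth_group_def)
qed

text \<open>
  Every group element that is needed has at most two nonzero entries in each row, at the columns \<open>\<pi>
  i\<close> and \<open>\<rho> i\<close>; the two entries add up if the columns coincide.
\<close>

definition sparse_mat :: "nat \<Rightarrow> (nat \<Rightarrow> nat) \<Rightarrow> (nat \<Rightarrow> complex) \<Rightarrow> (nat \<Rightarrow> nat) \<Rightarrow> (nat \<Rightarrow> complex) \<Rightarrow> complex mat" where
  "sparse_mat n \<pi> c \<rho> d = mat n n (\<lambda>(i, j). (if j = \<pi> i then c i else 0) + (if j = \<rho> i then d i else 0))"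

lemma sparse_mat_carrier [simp]: "sparse_mat n \<pi> c \<rho> d \<in> carrier_mat n n"
  by (simp add: sparse_mat_def)

lemma sparse_mat_mult [simp]:
  assumes "v \<in> carrier_vec n" "i < n" "\<pi> i < n" "\<rho> i < n"
  shows "(sparse_mat n \<pi> c \<rho> d *\<^sub>v v) $ i = c i * v $ \<pi> i + d i * v $ \<rho> i"
proof -
  have "(sparse_mat n \<pi> c \<rho> d *\<^sub>v v) $ i
      = (\<Sum>j\<in>{0..<n}. (if j = \<pi> i then c i * v $ j else 0) + (if j = \<rho> i then d i * v $ j else 0))"
    using assms by (simp add: sparse_mat_def scalar_prod_def) (intro sum.cong refl, simp add: algebra_simps)
  then show ?thesis using assms by (simp add: sum.distrib)
qed

text \<open>
  The exchange of the two basis vectors of plane \<open>0\<close>; the torus of plane \<open>r\<close>; and the unipotent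
  element that sends \<open>x\<^sub>0\<close> to \<open>x\<^sub>0 + z x\<^sub>r\<close> and \<open>y\<^sub>r\<close> to \<open>y\<^sub>r - z y\<^sub>0\<close>.
\<close>

definition swap_mat :: "nat \<Rightarrow> complex mat" where
  "swap_mat n = sparse_mat n (transpose 0 1) (\<lambda>_. 1) id (\<lambda>_. 0)"

definition torus_mat :: "nat \<Rightarrow> nat \<Rightarrow> complex \<Rightarrow> complex mat" where
  "torus_mat n r z = sparse_mat n id (\<lambda>i. if i = 2 * r then z else if i = 2 * r + 1 then inverse z else 1) id (\<lambda>_. 0)"

definition shear_mat :: "nat \<Rightarrow> nat \<Rightarrow> complex \<Rightarrow> complex mat" where
  "shear_mat n r z = sparse_mat n id (\<lambda>_. 1) (\<lambda>i. if i = 2 * r then 0 else 2 * r + 1)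
     (\<lambda>i. if i = 2 * r then z else if i = 1 then - z else 0)"

lemma swap_mat_carrier [simp]:
  "swap_mat n \<in> carrier_mat n n"
  "dim_row (swap_mat n) = n"
  "v \<in> carrier_vec n \<Longrightarrow> swap_mat n *\<^sub>v v \<in> carrier_vec n"
  by (simp_all add: swap_mat_def sparse_mat_def mult_mat_vec_carrier[of _ n n])

lemma torus_mat_carrier [simp]:
  "torus_mat n r z \<in> carrier_mat n n"
  "dim_row (torus_mat n r z) = n"
  "v \<in> carrier_vec n \<Longrightarrow> torus_mat n r z *\<^sub>v v \<in> carrier_vec n"
  by (simp_all add: torus_mat_def sparse_mat_def mult_mat_vec_carrier[of _ n n])

lemma shear_mat_carrier [simp]:
  "shear_mat n r z \<in> carrier_mat n n"
  "dim_row (shear_mat n r z) = n"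
  "v \<in> carrier_vec n \<Longrightarrow> shear_mat n r z *\<^sub>v v \<in> carrier_vec n"
  by (simp_all add: shear_mat_def sparse_mat_def mult_mat_vec_carrier[of _ n n])

lemma transpose_less: "2 \<le> n \<Longrightarrow> i < n \<Longrightarrow> transpose 0 (Suc 0) i < n"
  by (simp add: transpose_def)

lemma swap_mat_nth:
  assumes "2 \<le> n" "v \<in> carrier_vec n" "i < n"
  shows "(swap_mat n *\<^sub>v v) $ i = v $ transpose 0 1 i"
  using assms by (simp add: swap_mat_def transpose_less)

lemma torus_mat_nth:
  assumes "v \<in> carrier_vec n" "i < n"
  shows "(torus_mat n r z *\<^sub>v v) $ i = (if i = 2 * r then z else if i = 2 * r + 1 then inverse z else 1) * v $ i"
  using assms by (simp add: torus_mat_def)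

lemma shear_mat_nth:
  assumes "2 * r + 1 < n" "v \<in> carrier_vec n" "i < n"
  shows "(shear_mat n r z *\<^sub>v v) $ i =
    v $ i + (if i = 2 * r then z * v $ 0 else if i = 1 then - z * v $ (2 * r + 1) else 0)"
  using assms by (simp add: shear_mat_def)

lemma swap_mat_orth:
  assumes n: "2 \<le> n"
  shows "swap_mat n \<in> orth_group n"
proof (rule orth_groupI)
  show inv: "swap_mat n *\<^sub>v (swap_mat n *\<^sub>v v) = v" if "v \<in> carrier_vec n" for v
    by (rule eq_vecI) (use that n in \<open>simp_all add: swap_mat_nth transpose_less del: index_mult_mat_vec\<close>)
  show "swap_mat n *\<^sub>v (swap_mat n *\<^sub>v v) = v" if "v \<in> carrier_vec n" for v
    using inv that .
  show "quad n (swap_mat n *\<^sub>v v) = quad n v" if v: "v \<in> carrier_vec n" for v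
    unfolding quad_def
  proof (rule sum.cong[OF refl])
    fix r assume "r \<in> {..<n div 2}"
    then show "(swap_mat n *\<^sub>v v) $ (2 * r) * (swap_mat n *\<^sub>v v) $ (2 * r + 1) = v $ (2 * r) * v $ (2 * r + 1)"
      using v n by (cases "r = 0") (simp_all add: swap_mat_nth transpose_def del: index_mult_mat_vec)
  qed
qed simp_all

lemma torus_mat_orth:
  assumes z: "z \<noteq> 0"
  shows "torus_mat n r z \<in> orth_group n"
proof (rule orth_groupI)
  show "torus_mat n r z *\<^sub>v (torus_mat n r (inverse z) *\<^sub>v v) = v" if "v \<in> carrier_vec n" for v
    by (rule eq_vecI) (use that z in \<open>auto simp add: torus_mat_nth simp del: index_mult_mat_vec\<close>)
  show "torus_mat n r (inverse z) *\<^sub>v (torus_mat n r z *\<^sub>v v) = v" if "v \<in> carrier_vec n" for v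
    by (rule eq_vecI) (use that z in \<open>auto simp add: torus_mat_nth simp del: index_mult_mat_vec\<close>)
  show "quad n (torus_mat n r z *\<^sub>v v) = quad n v" if v: "v \<in> carrier_vec n" for v
    unfolding quad_def
  proof (rule sum.cong[OF refl])
    fix q assume "q \<in> {..<n div 2}"
    moreover have "2 * q \<noteq> 2 * r + 1" "2 * q + 1 \<noteq> 2 * r" by presburger+
    ultimately show "(torus_mat n r z *\<^sub>v v) $ (2 * q) * (torus_mat n r z *\<^sub>v v) $ (2 * q + 1) = v $ (2 * q) * v $ (2 * q + 1)"
      using v z by (auto simp add: torus_mat_nth simp del: index_mult_mat_vec)
  qed
qed simp_all

lemma shear_mat_orth:
  assumes r: "0 < r" "r < n div 2"
  shows "shear_mat n r z \<in> orth_group n"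
proof (rule orth_groupI)
  have rn: "2 * r + 1 < n" "0 < n" "1 < n" using r by auto
  have inv: "shear_mat n r x *\<^sub>v (shear_mat n r (- x) *\<^sub>v v) = v" if "v \<in> carrier_vec n" for v x
    by (rule eq_vecI) (use that rn r in \<open>auto simp add: shear_mat_nth simp del: index_mult_mat_vec\<close>)
  show "shear_mat n r z *\<^sub>v (shear_mat n r (- z) *\<^sub>v v) = v" if "v \<in> carrier_vec n" for v
    using inv[OF that] .
  show "shear_mat n r (- z) *\<^sub>v (shear_mat n r z *\<^sub>v v) = v" if "v \<in> carrier_vec n" for v
    using inv[OF that, of "- z"] by simp
  show "quad n (shear_mat n r z *\<^sub>v v) = quad n v" if v: "v \<in> carrier_vec n" for v
  proof -
    \<comment> \<open>The two planes involved change by opposite amounts.\<close>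
    let ?t = "z * v $ 0 * v $ (2 * r + 1)"
    have "quad n (shear_mat n r z *\<^sub>v v) = (\<Sum>q<n div 2. v $ (2 * q) * v $ (2 * q + 1)
        + ((if q = r then ?t else 0) - (if q = 0 then ?t else 0)))"
      unfolding quad_def
    proof (rule sum.cong[OF refl])
      fix q assume "q \<in> {..<n div 2}"
      then have q: "2 * q + 1 < n" "2 * q < n" by auto
      moreover have "2 * q \<noteq> 1" "2 * q + 1 \<noteq> 2 * r" by presburger+
      ultimately show "(shear_mat n r z *\<^sub>v v) $ (2 * q) * (shear_mat n r z *\<^sub>v v) $ (2 * q + 1) =
          v $ (2 * q) * v $ (2 * q + 1) + ((if q = r then ?t else 0) - (if q = 0 then ?t else 0))"
        using v rn r by (auto simp add: shear_mat_nth algebra_simps simp del: index_mult_mat_vec)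
    qed
    also have "\<dots> = quad n v"
      using r by (simp add: quad_def sum.distrib sum_subtractf)
    finally show ?thesis .
  qed
qed simp_all

lemma swap_mat_unit:
  assumes "2 \<le> n" "k < n"
  shows "swap_mat n *\<^sub>v e n k = e n (transpose 0 1 k)"
  by (rule eq_vecI) (use assms in \<open>auto simp: swap_mat_nth transpose_less transpose_def simp del: index_mult_mat_vec\<close>)

lemma torus_mat_unit:
  assumes "k < n"
  shows "torus_mat n r z *\<^sub>v e n k = (if k = 2 * r then z else if k = 2 * r + 1 then inverse z else 1) \<cdot>\<^sub>v e n k"
  by (rule eq_vecI) (use assms in \<open>auto simp: torus_mat_nth simp del: index_mult_mat_vec\<close>)

lemma shear_mat_unit:
  assumes "0 < r" "2 * r + 1 < n" "k < n"
  shows "shear_mat n r 1 *\<^sub>v e n k =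
    (if k = 0 then e n 0 + e n (2 * r) else if k = 2 * r + 1 then e n (2 * r + 1) - e n 1 else e n k)"
  by (rule eq_vecI) (use assms in \<open>auto simp: shear_mat_nth simp del: index_mult_mat_vec\<close>)

definition integral_vec :: "nat \<Rightarrow> complex vec \<Rightarrow> bool" where
  "integral_vec n v \<longleftrightarrow> v \<in> carrier_vec n \<and> (\<forall>k<n. v $ k \<in> \<int>)"

lemma integral_vec_simps [simp]:
  "integral_vec n (e n k)"
  "integral_vec n u \<Longrightarrow> integral_vec n v \<Longrightarrow> integral_vec n (u + v)"
  "integral_vec n u \<Longrightarrow> integral_vec n v \<Longrightarrow> integral_vec n (u - v)"
  by (auto simp: integral_vec_def unit_vec_def)

lemma integral_vec_carrier: "integral_vec n v \<Longrightarrow> v \<in> carrier_vec n"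
  by (simp add: integral_vec_def)

lemma mlpart_integral:
  assumes "f \<in> invariants_int n m" "\<And>i. i < m \<Longrightarrow> integral_vec n (v i)"
  shows "mlpart n m T f v \<in> \<int>"
  using assms by (intro mlpart_Ints) (auto simp: invariants_int_def R_int_def integral_vec_def)

lemma mlpart_move:
  assumes f: "f \<in> invariants_int n m" and A: "A \<in> orth_group n" and T: "T \<subseteq> {..<m}"
    and v: "\<And>i. i < m \<Longrightarrow> integral_vec n (v i)" and w: "\<And>i. i \<in> T \<Longrightarrow> A *\<^sub>v v i = w i"
  shows "mlpart n m T f v = mlpart n m T f w"
proof -
  have "mlpart n m T f v = mlpart n m T f (\<lambda>i. A *\<^sub>v v i)"
    by (rule mlpart_invariant[OF _ A T, symmetric])
      (use f v in \<open>auto simp: invariants_int_def integral_vec_carrier\<close>)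
  also have "\<dots> = mlpart n m T f w" by (rule mlpart_cong) (rule w)
  finally show ?thesis .
qed

text \<open>
  Expanding \<open>v i = x\<^sub>0 + y\<^sub>0\<close> gives two integers, which the exchange of \<open>x\<^sub>0\<close> and \<open>y\<^sub>0\<close> shows to be
  equal.
\<close>

lemma mlpart_even_swap:
  assumes f: "f \<in> invariants_int n m" and n: "2 \<le> n" and T: "T \<subseteq> {..<m}"
    and v: "\<And>j. j < m \<Longrightarrow> integral_vec n (v j)"
    and i: "i \<in> T" "v i = e n 0 + e n 1"
    and fix_others: "\<And>j. j \<in> T \<Longrightarrow> j \<noteq> i \<Longrightarrow> swap_mat n *\<^sub>v v j = v j"
  shows "mlpart n m T f v / 2 \<in> \<int>"
proof -
  have im: "i < m" using i T by auto
  have "v = v(i := e n 0 + e n 1)"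
    using i by (metis fun_upd_triv)
  moreover have "mlpart n m T f (v(i := e n 0 + e n 1))
      = mlpart n m T f (v(i := e n 0)) + mlpart n m T f (v(i := e n 1))"
    by (rule mlpart_add) (use i im in auto)
  moreover have "mlpart n m T f (v(i := e n 0)) = mlpart n m T f (v(i := e n 1))"
    by (rule mlpart_move[OF f swap_mat_orth[OF n] T, where w = "v(i := e n 1)"]) (use v n fix_others in \<open>auto simp: swap_mat_unit\<close>)
  ultimately have "mlpart n m T f v / 2 = mlpart n m T f (v(i := e n 1))" by simp
  also have "\<dots> \<in> \<int>" by (rule mlpart_integral[OF f]) (use v in auto)
  finally show ?thesis .
qed

text \<open>
  The torus of plane \<open>r\<close> moves only one argument, which has nonzero weight. The parameter \<open>2\<close> or
  \<open>1/2\<close> is chosen so that this argument is doubled.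
\<close>

lemma mlpart_zero_torus:
  assumes f: "f \<in> invariants_int n m" and T: "T \<subseteq> {..<m}"
    and v: "\<And>j. j < m \<Longrightarrow> integral_vec n (v j)"
    and i: "i \<in> T" "v i = e n k" and k: "k < n" "k div 2 = r"
    and fix_others: "\<And>j z. j \<in> T \<Longrightarrow> j \<noteq> i \<Longrightarrow> torus_mat n r z *\<^sub>v v j = v j"
  shows "mlpart n m T f v = 0"
proof -
  have im: "i < m" using i T by auto
  define z :: complex where "z = (if k = 2 * r then 2 else 1 / 2)"
  have "k = 2 * r \<or> k = 2 * r + 1" using k(2) by auto
  then have Ai: "torus_mat n r z *\<^sub>v v i = 2 \<cdot>\<^sub>v v i"
    using k by (auto simp: i torus_mat_unit z_def)
  have "mlpart n m T f v = mlpart n m T f (v(i := 2 \<cdot>\<^sub>v v i))"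
    by (rule mlpart_move[OF f torus_mat_orth[of z n r] T v]) (use fix_others Ai in \<open>auto simp: z_def\<close>)
  also have "2 \<cdot>\<^sub>v v i = 1 \<cdot>\<^sub>v v i + 1 \<cdot>\<^sub>v v i"
    by (rule eq_vecI) auto
  also have "mlpart n m T f (v(i := 1 \<cdot>\<^sub>v v i + 1 \<cdot>\<^sub>v v i)) =
      1 * mlpart n m T f (v(i := v i)) + 1 * mlpart n m T f (v(i := v i))"
    by (rule mlpart_linear) (use i im v integral_vec_carrier in auto)
  also have "\<dots> = 2 * mlpart n m T f v" unfolding fun_upd_triv by simp
  finally show ?thesis by simp
qed

text \<open>
  The tuple of vectors that detects indecomposability: \<open>y\<^sub>0\<close> once, then \<open>x\<^sub>0 + y\<^sub>0\<close> in the positions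
  \<open>1, \<dots>, m - n + 1\<close>, and then the bases of the planes \<open>1, \<dots>, \<nu> - 1\<close>. The first block absorbs all the
  excess of \<open>m\<close> over \<open>n\<close>. Having one \<open>y\<^sub>0\<close> instead of a further \<open>x\<^sub>0 + y\<^sub>0\<close> divides all values by
  \<open>2\<close>, so that congruences modulo \<open>2\<close> suffice.
\<close>

definition probe :: "nat \<Rightarrow> nat \<Rightarrow> nat \<Rightarrow> complex vec" where
  "probe n m i = (if i = 0 then e n 1 else if i < m - n + 2 then e n 0 + e n 1 else e n (i - (m - n)))"

lemma integral_probe [simp]: "integral_vec n (probe n m i)"
  by (simp add: probe_def)

lemma swap_mat_sum:
  assumes "2 \<le> n"
  shows "swap_mat n *\<^sub>v (e n 0 + e n 1) = e n 0 + e n 1"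
  using assms by (simp add: mult_add_distrib_mat_vec[of _ n n] swap_mat_unit comm_add_vec[of _ n])

lemma swap_mat_probe:
  assumes "2 \<le> n" "n < m" "i < m" "i \<noteq> 0"
  shows "swap_mat n *\<^sub>v probe n m i = probe n m i"
  using assms swap_mat_sum[of n] by (auto simp: probe_def swap_mat_unit transpose_def)

lemma mlpart_probe_even_without_0:
  assumes f: "f \<in> invariants_int n m" and n: "2 \<le> n" "n < m" and T: "T \<subseteq> {..<m}"
    and "0 \<notin> T" "i \<in> T" "i < m - n + 2"
  shows "mlpart n m T f (probe n m) / 2 \<in> \<int>"
proof (rule mlpart_even_swap[OF f n(1) T _ \<open>i \<in> T\<close>])
  show "probe n m i = e n 0 + e n 1" using assms by (auto simp: probe_def)
  show "swap_mat n *\<^sub>v probe n m j = probe n m j" if "j \<in> T" "j \<noteq> i" for j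
  proof -
    have "j \<noteq> 0" "j < m" using that T \<open>0 \<notin> T\<close> by (metis, auto)
    then show ?thesis using swap_mat_probe n by blast
  qed
qed simp

lemma torus_mat_probe:
  assumes "2 \<le> n" "n < m" "i < m" "0 < r" and "i - (m - n) \<noteq> 2 * r" "i - (m - n) \<noteq> 2 * r + 1"
  shows "torus_mat n r z *\<^sub>v probe n m i = probe n m i"
  using assms by (auto simp: probe_def mult_add_distrib_mat_vec[of _ n n] torus_mat_unit)

lemma shear_mat_probe:
  assumes "2 \<le> n" "n < m" "i < m" "0 < r" "2 * r + 1 < n" and "i - (m - n) \<noteq> 2 * r + 1"
    and "0 < i \<Longrightarrow> m - n + 2 \<le> i"
  shows "shear_mat n r 1 *\<^sub>v probe n m i = probe n m i"
  using assms by (auto simp: probe_def shear_mat_unit)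


text \<open>
  Here the geometry of \<open>O(n)\<close> beyond plane \<open>0\<close> enters. Some basis vector of a plane \<open>r\<close>, \<open>r > 0\<close>, is
  not used by \<open>T\<close>. If its partner is used, the value is zero by the torus of that plane. Otherwise
  plane \<open>r\<close> is free. The unipotent element mixing the planes \<open>0\<close> and \<open>r\<close> then relates the value to
  values in which \<open>y\<^sub>0\<close> is replaced by \<open>y\<^sub>r\<close>, and these are even by the exchange of \<open>x\<^sub>0\<close> and \<open>y\<^sub>0\<close>,
  since \<open>y\<^sub>0\<close> no longer occurs alone. The last of them must keep an argument \<open>x\<^sub>0 + y\<^sub>0\<close> after one
  such argument has been replaced by \<open>x\<^sub>r\<close>; there are \<open>m - n + 1 \<ge> 3\<close> of them at the start, which is
  where \<open>m > n\<close> is used.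
\<close>

lemma mlpart_probe_even_incomplete:
  assumes f: "f \<in> invariants_int n m" and n: "2 \<le> n" "n < m" "even n" "even m"
    and T: "T \<subseteq> {..<m}" "T \<noteq> {..<m}" and V: "{..<m - n + 2} \<subseteq> T"
  shows "mlpart n m T f (probe n m) / 2 \<in> \<int>"
proof -
  let ?d = "m - n"
  let ?w = "probe n m"
  let ?F = "mlpart n m T f"
  obtain j where j: "j < m" "j \<notin> T" using T by blast
  then have jV: "?d + 2 \<le> j" using V by (meson lessThan_iff not_le subsetD)
  define r where "r = (j - ?d) div 2"
  have r: "0 < r" "2 * r + 1 < n" "r < n div 2"
  proof -
    have "0 < l div 2 \<and> 2 * (l div 2) + 1 < n \<and> l div 2 < n div 2" if "2 \<le> l" "l < n" for l
      using that n(3) by presburger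
    from this[of "j - ?d"] show "0 < r" "2 * r + 1 < n" "r < n div 2"
      using jV j(1) n(2) by (auto simp: r_def)
  qed
  define j' where "j' = ?d + (if j - ?d = 2 * r then 2 * r + 1 else 2 * r)"
  have "j - ?d = 2 * r \<or> j - ?d = 2 * r + 1" unfolding r_def by presburger
  then have "j = ?d + 2 * r \<and> j' = ?d + 2 * r + 1 \<or> j = ?d + 2 * r + 1 \<and> j' = ?d + 2 * r"
    using jV unfolding j'_def by (auto simp del: diff_diff_left)
  then have jj: "{j, j'} = {?d + 2 * r, ?d + 2 * r + 1}" by blast
  have "?d + n = m" using n(2) by simp
  moreover have "?d + 2 * r \<le> j'" "j' \<le> ?d + 2 * r + 1" by (simp_all add: j'_def)
  ultimately have j': "j' < m" "?d + 2 \<le> j'" using r by linarith+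
  have other: "i - ?d \<noteq> 2 * r" "i - ?d \<noteq> 2 * r + 1" if "i \<in> T" "i \<noteq> j'" for i
  proof -
    have "i \<noteq> j" using that(1) j(2) by metis
    then have "i \<notin> {?d + 2 * r, ?d + 2 * r + 1}" unfolding jj[symmetric] using that(2) by simp
    then show "i - ?d \<noteq> 2 * r" "i - ?d \<noteq> 2 * r + 1" using r(1) by auto
  qed
  have less: "i < m" if "i \<in> T" for i using that T by auto
  have Vd: "i \<in> T" if "i < ?d + 2" for i using that V by (meson lessThan_iff subsetD)
  have d2: "2 \<le> ?d" using n(2-4) by presburger
  show ?thesis
  proof (cases "j' \<in> T")
    case True
    have "?F ?w = 0"
    proof (rule mlpart_zero_torus[OF f T(1) _ True])
      show "?w j' = e n (j' - ?d)" using j'(2) by (simp add: probe_def)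
      show "j' - ?d < n" "(j' - ?d) div 2 = r" using r by (auto simp: j'_def)
      show "torus_mat n r z *\<^sub>v ?w i = ?w i" if "i \<in> T" "i \<noteq> j'" for i z
        by (rule torus_mat_probe) (use n r other[OF that] less[OF that(1)] in auto)
    qed simp
    then show ?thesis by simp
  next
    case False
    then have other: "i - ?d \<noteq> 2 * r" "i - ?d \<noteq> 2 * r + 1" if "i \<in> T" for i
      using other that by metis+
    let ?x = "e n (2 * r)" and ?y = "e n (2 * r + 1)"
    define G where "G i = (if 0 < i \<and> i < ?d + 2 then e n 0 + e n 1 + ?x else ?w i)" for i
    have intG [simp]: "integral_vec n (G i)" for i by (simp add: G_def)
    have shear_w: "shear_mat n r 1 *\<^sub>v ?w i = G i" if "i \<in> T" for i
    proof (cases "0 < i \<and> i < ?d + 2")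
      case True
      have "shear_mat n r 1 *\<^sub>v (e n 0 + e n 1) = e n 0 + ?x + e n 1"
        using r n by (simp add: mult_add_distrib_mat_vec[of _ n n] shear_mat_unit)
      also have "\<dots> = e n 0 + e n 1 + ?x" by (rule eq_vecI) auto
      finally show ?thesis using True by (simp add: G_def probe_def)
    next
      case F: False
      have "shear_mat n r 1 *\<^sub>v ?w i = ?w i"
        by (rule shear_mat_probe) (use F n r other[OF that] less[OF that] in auto)
      then show ?thesis using F unfolding G_def by presburger
    qed
    have swap_w: "swap_mat n *\<^sub>v ?w i = ?w i" if "i \<in> T" "i \<noteq> 0" for i
      by (rule swap_mat_probe) (use that less n in auto)
    have swap_G: "swap_mat n *\<^sub>v G i = G i" if "i \<in> T" "i \<noteq> 0" for i
    proof -
      have "swap_mat n *\<^sub>v (e n 0 + e n 1 + ?x) = e n 0 + e n 1 + ?x"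
        using swap_mat_sum[of n] n r by (simp add: mult_add_distrib_mat_vec[of _ n n] swap_mat_unit transpose_def)
      then show ?thesis using swap_w[OF that] by (simp add: G_def)
    qed
    have swap_xy: "swap_mat n *\<^sub>v ?x = ?x" "swap_mat n *\<^sub>v ?y = ?y"
      using n r by (simp_all add: swap_mat_unit transpose_def)
    have w1: "?w 1 = e n 0 + e n 1" "?w 2 = e n 0 + e n 1" "?w 0 = e n 1"
      using d2 n(2) by (simp_all add: probe_def)
    have in_T: "0 \<in> T" "1 \<in> T" "2 \<in> T" using Vd d2 by auto
    have in_m: "0 < m" "1 < m" using less in_T by auto
    note move = mlpart_move[OF f shear_mat_orth[OF r(1,3), of 1] T(1)]
    have 1: "?F (?w(0 := ?y)) / 2 \<in> \<int>"
      by (rule mlpart_even_swap[OF f n(1) T(1) _ in_T(2)]) (use w1 swap_w swap_xy in auto)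
    \<comment> \<open>The shear fixes \<open>y\<^sub>0\<close>, so it turns \<open>?w\<close> itself into \<open>G\<close>; with \<open>y\<^sub>r\<close> in place of \<open>y\<^sub>0\<close> it gives
        a second relation, from which \<open>?F ?w\<close> can be solved.\<close>
    have "?F (?w(0 := ?y)) = ?F (G(0 := 1 \<cdot>\<^sub>v ?y + (-1) \<cdot>\<^sub>v e n 1))"
    proof (rule move)
      have "?y - e n 1 = 1 \<cdot>\<^sub>v ?y + (-1) \<cdot>\<^sub>v e n 1" by (rule eq_vecI) auto
      then show "shear_mat n r 1 *\<^sub>v (?w(0 := ?y)) i = (G(0 := 1 \<cdot>\<^sub>v ?y + (-1) \<cdot>\<^sub>v e n 1)) i" if "i \<in> T" for i
        using shear_w[OF that] r by (simp add: shear_mat_unit)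
    qed simp
    also have "\<dots> = 1 * ?F (G(0 := ?y)) + (-1) * ?F (G(0 := e n 1))"
      by (rule mlpart_linear) (use in_T in_m in auto)
    also have "G(0 := e n 1) = G" using w1(3) by (auto simp: G_def)
    also have "?F G = ?F ?w" by (rule move[symmetric]) (use shear_w in auto)
    finally have 2: "?F ?w = ?F (G(0 := ?y)) - ?F (?w(0 := ?y))" by (simp del: fun_upd_apply)
    have "?F (G(0 := ?y)) = ?F ((G(0 := ?y))(1 := (e n 0 + e n 1) + ?x))"
      using d2 by (intro arg_cong[where f = ?F]) (auto simp: G_def)
    also have "\<dots> = ?F ((G(0 := ?y))(1 := e n 0 + e n 1)) + ?F ((G(0 := ?y))(1 := ?x))"
      by (rule mlpart_add) (use in_T in_m in auto)
    finally have 3: "?F (G(0 := ?y)) = ?F ((G(0 := ?y))(1 := e n 0 + e n 1)) + ?F ((G(0 := ?y))(1 := ?x))" .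
    have 4: "?F ((G(0 := ?y))(1 := e n 0 + e n 1)) / 2 \<in> \<int>"
      by (rule mlpart_even_swap[OF f n(1) T(1) _ in_T(2)]) (use swap_G swap_xy in auto)
    \<comment> \<open>Here \<open>y\<^sub>r + y\<^sub>0\<close> is the preimage of \<open>y\<^sub>r\<close> under the shear.\<close>
    have "?F ((G(0 := ?y))(1 := ?x)) = ?F ((?w(1 := ?x))(0 := ?y + e n 1))"
    proof (rule move[symmetric])
      fix i assume i: "i \<in> T"
      have "?y - e n 1 + e n 1 = ?y" by (rule eq_vecI) auto
      then show "shear_mat n r 1 *\<^sub>v ((?w(1 := ?x))(0 := ?y + e n 1)) i = ((G(0 := ?y))(1 := ?x)) i"
        using shear_w[OF i] r n by (auto simp: mult_add_distrib_mat_vec[of _ n n] shear_mat_unit)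
    qed simp
    also have "\<dots> = ?F ((?w(1 := ?x))(0 := ?y)) + ?F ((?w(1 := ?x))(0 := e n 1))"
      by (rule mlpart_add) (use in_T in_m in auto)
    also have "?F ((?w(1 := ?x))(0 := e n 1)) = 0"
    proof (rule mlpart_zero_torus[OF f T(1) _ in_T(2), of _ "2 * r" r])
      show "torus_mat n r z *\<^sub>v ((?w(1 := ?x))(0 := e n 1)) i = ((?w(1 := ?x))(0 := e n 1)) i"
        if "i \<in> T" "i \<noteq> 1" for i z
        using torus_mat_probe[of n m i r z] n r other[OF that(1)] less[OF that(1)] that(2) w1(3) by auto
    qed (use r in auto)
    finally have 5: "?F ((G(0 := ?y))(1 := ?x)) = ?F ((?w(1 := ?x))(0 := ?y))" by (simp del: fun_upd_apply)
    have 6: "?F ((?w(1 := ?x))(0 := ?y)) / 2 \<in> \<int>"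
      by (rule mlpart_even_swap[OF f n(1) T(1) _ in_T(3)]) (use w1 swap_w swap_xy in auto)
    have "?F ?w / 2 = ?F ((G(0 := ?y))(1 := e n 0 + e n 1)) / 2
        + ?F ((?w(1 := ?x))(0 := ?y)) / 2 - ?F (?w(0 := ?y)) / 2"
      unfolding 2 3 5 by (simp add: field_simps)
    then show ?thesis using 1 4 6 by (simp only: Ints_add Ints_diff)
  qed
qed

section \<open>The invariant \<open>g_tilde\<close>\<close>

definition ml_polys :: "nat \<Rightarrow> nat \<Rightarrow> nat set \<Rightarrow> cpoly set" where
  "ml_polys n m T = {f. \<forall>s\<in>Poly_Mapping.keys f. ml_monom n m T s}"

lemma ml_polys_lookup:
  "f \<in> ml_polys n m T \<longleftrightarrow> (\<forall>s. Poly_Mapping.lookup f s \<noteq> 0 \<longrightarrow> ml_monom n m T s)"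
  by (auto simp: ml_polys_def in_keys_iff)

lemma ml_polys_zero: "0 \<in> ml_polys n m T"
  by (simp add: ml_polys_def)

lemma ml_polys_add: "f \<in> ml_polys n m T \<Longrightarrow> g \<in> ml_polys n m T \<Longrightarrow> f + g \<in> ml_polys n m T"
  unfolding ml_polys_lookup lookup_add by (metis add.left_neutral)

lemma ml_polys_diff: "f \<in> ml_polys n m T \<Longrightarrow> g \<in> ml_polys n m T \<Longrightarrow> f - g \<in> ml_polys n m T"
  unfolding ml_polys_lookup lookup_minus by (metis diff_self)

lemma ml_polys_mult:
  assumes "f \<in> ml_polys n m U" "g \<in> ml_polys n m W" "U \<inter> W = {}"
  shows "f * g \<in> ml_polys n m (U \<union> W)"
  using assms keys_mult[of f g] ml_monom_addI[OF _ _ assms(3)] unfolding ml_polys_def by blast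

lemma ml_polys_cconst: "cconst c \<in> ml_polys n m {}"
  by (auto simp: ml_polys_def cconst_def ml_monom_def vdeg_def)

lemma ml_polys_cvar:
  assumes "i < m" "k < n"
  shows "cvar i k \<in> ml_polys n m {i}"
proof -
  have "vdeg n (Poly_Mapping.single (i, k) 1) j = (if j = i then 1 else 0)" for j
    using assms(2) by (simp add: vdeg_def lookup_single when_def)
  then show ?thesis using assms by (auto simp: ml_polys_def cvar_def ml_monom_def)
qed

lemma ml_polys_B:
  assumes ij: "i < m" "j < m" "i \<noteq> j"
  shows "B n i j \<in> ml_polys n m {i, j}"
proof -
  have "(\<Sum>r\<in>X. xvar r i * yvar r j + yvar r i * xvar r j) \<in> ml_polys n m {i, j}"
    if "finite X" "X \<subseteq> {..<n div 2}" for X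
    using that
  proof (induction X rule: finite_induct)
    case (insert r X)
    then have r: "2 * r < n" "2 * r + 1 < n" by auto
    have "xvar r i * yvar r j \<in> ml_polys n m ({i} \<union> {j})" "yvar r i * xvar r j \<in> ml_polys n m ({i} \<union> {j})"
      unfolding xvar_def yvar_def by (intro ml_polys_mult ml_polys_cvar; use ij r in simp)+
    moreover have "{i} \<union> {j} = {i, j}" by auto
    ultimately show ?case using insert by (simp add: ml_polys_add)
  qed (simp add: ml_polys_zero)
  then show ?thesis by (simp add: B_def)
qed

lemma ml_polys_alt_sum:
  assumes "\<And>us y ws. xs = us @ y # ws \<Longrightarrow> f y (us @ ws) \<in> ml_polys n m T"
  shows "alt_sum f xs \<in> ml_polys n m T"
  using assms
proof (induction xs arbitrary: f)
  case (Cons x xs)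
  have "f x xs \<in> ml_polys n m T" using Cons.prems[of "[]"] by simp
  moreover have "alt_sum (\<lambda>y ys. f y (x # ys)) xs \<in> ml_polys n m T"
    by (rule Cons.IH) (use Cons.prems[of "x # _"] in auto)
  ultimately show ?case by (simp add: ml_polys_diff)
qed (simp add: ml_polys_zero)

lemma ml_polys_list_pf:
  "distinct xs \<Longrightarrow> set xs \<subseteq> {..<m} \<Longrightarrow> length xs = 2 * k \<Longrightarrow> list_pf (B n) k xs \<in> ml_polys n m (set xs)"
proof (induction k arbitrary: xs)
  case 0
  then show ?case using ml_polys_cconst[of 1 n m] by (simp add: cconst_def)
next
  case (Suc k)
  then obtain u us where xs: "xs = u # us" by (cases xs) auto
  show ?case unfolding xs list_pf.simps list.sel
  proof (rule ml_polys_alt_sum)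
    fix vs y ws assume us: "us = vs @ y # ws"
    have "B n u y \<in> ml_polys n m {u, y}" by (rule ml_polys_B) (use Suc.prems in \<open>auto simp: xs us\<close>)
    moreover have "list_pf (B n) k (vs @ ws) \<in> ml_polys n m (set (vs @ ws))"
      by (rule Suc.IH) (use Suc.prems in \<open>auto simp: xs us\<close>)
    ultimately have "B n u y * list_pf (B n) k (vs @ ws) \<in> ml_polys n m ({u, y} \<union> set (vs @ ws))"
      by (rule ml_polys_mult) (use Suc.prems in \<open>auto simp: xs us\<close>)
    then show "B n u y * list_pf (B n) k (vs @ ws) \<in> ml_polys n m (set (u # us))"
      by (simp add: us insert_commute)
  qed
qed

lemma g_tilde_conv_list_pf:
  assumes "even m"
  shows "g_tilde n m = cconst (2 powi (- (int (m div 2) - int (n div 2)))) * list_pf (B n) (m div 2) [0..<m]"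
proof -
  let ?p = "m div 2"
  have m: "m = 2 * ?p" using assms by simp
  have "pfaffian ?p (skew_B n) = pfaffian ?p (\<lambda>i j. skew_B n ([0..<m] ! i) ([0..<m] ! j))"
    by (rule pfaffian_cong) (use m in simp)
  also have "\<dots> = list_pf (skew_B n) ?p [0..<m]"
    by (rule pfaffian_conv_list_pf) (use m in simp)
  also have "\<dots> = list_pf (B n) ?p [0..<m]"
    by (rule list_pf_cong_sorted[where P = "(<)"]) (use m in \<open>simp_all add: skew_B_def\<close>)
  finally show ?thesis by (simp add: g_tilde_def)
qed

lemma g_tilde_ml: "even m \<Longrightarrow> g_tilde n m \<in> ml_polys n m {..<m}"
  using ml_polys_mult[OF ml_polys_cconst ml_polys_list_pf[of "[0..<m]" m "m div 2" n]]
  by (simp add: g_tilde_conv_list_pf atLeast0LessThan)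

lemma mlpart_ml_polys: "f \<in> ml_polys n m T \<Longrightarrow> mlpart n m T f v = poly_at f v"
  by (auto simp: mlpart_def poly_at_conv_lin lin_def ml_polys_def intro!: sum.cong)

lemma ml_polys_R: "f \<in> ml_polys n m T \<Longrightarrow> f \<in> R n m"
  by (auto simp: ml_polys_def R_def ml_monom_def)

lemma ml_polys_m_linear:
  assumes "f \<in> ml_polys n m {..<m}"
  shows "m_linear n m f"
  unfolding m_linear_def mlpart_ml_polys[OF assms, symmetric]
  using ml_polys_R[OF assms] by (auto intro!: mlpart_linear)

lemma total_degree_ml_polys:
  assumes "f \<in> ml_polys n m {..<m}"
  shows "total_degree f \<le> m"
  unfolding total_degree_def using assms
  by (subst Max_le_iff) (auto simp: ml_polys_def monom_degree_ml_monom)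

definition bil :: "nat \<Rightarrow> complex vec \<Rightarrow> complex vec \<Rightarrow> complex" where
  "bil n u w = (\<Sum>r<n div 2. u $ (2 * r) * w $ (2 * r + 1) + u $ (2 * r + 1) * w $ (2 * r))"

lemma bil_sym: "bil n u w = bil n w u"
  by (simp add: bil_def algebra_simps)

lemma bil_conv_quad:
  assumes "u \<in> carrier_vec n" "w \<in> carrier_vec n"
  shows "bil n u w = quad n (u + w) - quad n u - quad n w"
  unfolding bil_def quad_def sum_subtractf[symmetric]
proof (intro sum.cong refl)
  fix r assume "r \<in> {..<n div 2}"
  then have "2 * r < n" "2 * r + 1 < n" by auto
  then show "u $ (2 * r) * w $ (2 * r + 1) + u $ (2 * r + 1) * w $ (2 * r) =
      (u + w) $ (2 * r) * (u + w) $ (2 * r + 1) - u $ (2 * r) * u $ (2 * r + 1) - w $ (2 * r) * w $ (2 * r + 1)"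
    using assms by (simp add: algebra_simps)
qed

lemma bil_orth:
  assumes A: "A \<in> orth_group n" and uw: "u \<in> carrier_vec n" "w \<in> carrier_vec n"
  shows "bil n (A *\<^sub>v u) (A *\<^sub>v w) = bil n u w"
proof -
  have "A \<in> carrier_mat n n" "\<And>v. v \<in> carrier_vec n \<Longrightarrow> quad n (A *\<^sub>v v) = quad n v"
    using A by (auto simp: orth_group_def)
  then show ?thesis using uw by (simp add: bil_conv_quad mult_add_distrib_mat_vec[symmetric])
qed

lemma bil_add_left:
  assumes "u \<in> carrier_vec n" "v \<in> carrier_vec n"
  shows "bil n (u + v) w = bil n u w + bil n v w"
  unfolding bil_def sum.distrib[symmetric]
proof (intro sum.cong refl)
  fix r assume "r \<in> {..<n div 2}"
  then have "2 * r < n" "2 * r + 1 < n" by auto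
  then show "(u + v) $ (2 * r) * w $ (2 * r + 1) + (u + v) $ (2 * r + 1) * w $ (2 * r) =
      u $ (2 * r) * w $ (2 * r + 1) + u $ (2 * r + 1) * w $ (2 * r) +
      (v $ (2 * r) * w $ (2 * r + 1) + v $ (2 * r + 1) * w $ (2 * r))"
    using assms by (simp add: algebra_simps)
qed

text \<open>
  The Gram matrix of the standard basis, with integer entries, so that divisibility makes sense.
\<close>

definition hyp :: "nat \<Rightarrow> nat \<Rightarrow> nat \<Rightarrow> int" where
  "hyp n k l = (if k div 2 < n div 2 \<and> k div 2 = l div 2 \<and> k \<noteq> l then 1 else 0)"

lemma bil_unit: "bil n (e n k) (e n l) = of_int (hyp n k l)"
proof -
  have "bil n (e n k) (e n l) = (\<Sum>r<n div 2. if r = k div 2 then of_int (if k div 2 = l div 2 \<and> k \<noteq> l then 1 else 0) else 0)"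
    unfolding bil_def
  proof (intro sum.cong refl)
    fix r assume "r \<in> {..<n div 2}"
    then have r: "2 * r < n" "2 * r + 1 < n" by auto
    have unit: "e n i $ j = (if j = i then 1 else 0)" if "j < n" for i j
      using that by (simp add: unit_vec_def)
    have "e n k $ (2 * r) * e n l $ (2 * r + 1) + e n k $ (2 * r + 1) * e n l $ (2 * r) =
        of_int (if 2 * r = k \<and> 2 * r + 1 = l \<or> 2 * r + 1 = k \<and> 2 * r = l then 1 else 0)"
      unfolding unit[OF r(1)] unit[OF r(2)] by simp
    moreover have "2 * r = k \<and> 2 * r + 1 = l \<or> 2 * r + 1 = k \<and> 2 * r = l \<longleftrightarrow> r = k div 2 \<and> k div 2 = l div 2 \<and> k \<noteq> l"
    proof -
      have "2 * r = i \<longleftrightarrow> r = i div 2 \<and> even i" "2 * r + 1 = i \<longleftrightarrow> r = i div 2 \<and> odd i" for i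
        by (auto elim: evenE oddE)
      moreover have "k = l \<longleftrightarrow> k div 2 = l div 2 \<and> (even k \<longleftrightarrow> even l)"
        by (metis dvd_mult_div_cancel odd_two_times_div_two_succ)
      ultimately show ?thesis by metis
    qed
    ultimately show "e n k $ (2 * r) * e n l $ (2 * r + 1) + e n k $ (2 * r + 1) * e n l $ (2 * r) =
        (if r = k div 2 then of_int (if k div 2 = l div 2 \<and> k \<noteq> l then 1 else 0) else 0)"
      by simp
  qed
  then show ?thesis by (simp add: hyp_def)
qed

lemma poly_at_B: "poly_at (B n i j) v = bil n (v i) (v j)"
  by (simp add: B_def bil_def poly_at_sum poly_at_add poly_at_mult xvar_def yvar_def poly_at_cvar)

lemma poly_at_g_tilde:
  assumes "even m"
  shows "poly_at (g_tilde n m) v =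
    2 powi (- (int (m div 2) - int (n div 2))) * list_pf (bil n) (m div 2) (map v [0..<m])"
proof -
  have "poly_at (list_pf (B n) (m div 2) [0..<m]) v = list_pf (\<lambda>i j. poly_at (B n i j) v) (m div 2) [0..<m]"
    by (rule list_pf_hom) (simp_all add: poly_at_diff poly_at_mult)
  also have "\<dots> = list_pf (bil n) (m div 2) (map v [0..<m])"
    using assms by (simp add: poly_at_B list_pf_map)
  finally show ?thesis using assms by (simp add: g_tilde_conv_list_pf poly_at_mult poly_at_cconst)
qed

lemma g_tilde_invariant:
  assumes m: "even m"
  shows "g_tilde n m \<in> invariants n m"
proof -
  have "poly_at (g_tilde n m) (\<lambda>i. A *\<^sub>v v i) = poly_at (g_tilde n m) v"
    if A: "A \<in> orth_group n" and v: "\<forall>i<m. v i \<in> carrier_vec n" for A v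
  proof -
    have "list_pf (\<lambda>i j. bil n (A *\<^sub>v v i) (A *\<^sub>v v j)) (m div 2) [0..<m] = list_pf (\<lambda>i j. bil n (v i) (v j)) (m div 2) [0..<m]"
      by (rule list_pf_cong_sorted[where P = "\<lambda>i j. i < m \<and> j < m"])
        (use m v bil_orth[OF A] in \<open>auto simp: sorted_wrt_iff_nth_less\<close>)
    then have "list_pf (bil n) (m div 2) (map (\<lambda>i. A *\<^sub>v v i) [0..<m]) = list_pf (bil n) (m div 2) (map v [0..<m])"
      using m by (simp add: list_pf_map)
    then show ?thesis by (simp add: poly_at_g_tilde m)
  qed
  then show ?thesis using ml_polys_R[OF g_tilde_ml[OF m]] by (simp add: invariants_def)
qed

text \<open>
  A monomial that is linear in every vector selects one coordinate \<open>\<kappa> i\<close> of each vector, and it is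
  the only such monomial not vanishing at the corresponding tuple of basis vectors.
\<close>

lemma ml_polys_lookup_conv_poly_at:
  assumes f: "f \<in> ml_polys n m {..<m}" and s: "ml_monom n m {..<m} s"
  obtains \<kappa> where "\<And>i. i < m \<Longrightarrow> \<kappa> i < n" "Poly_Mapping.lookup f s = poly_at f (\<lambda>i. e n (\<kappa> i))"
proof -
  have "\<forall>i\<in>{..<m}. \<exists>k. k < n \<and> (\<forall>l<n. Poly_Mapping.lookup s (i, l) = (if l = k then 1 else 0))"
    using ml_monom_coordinate[OF s] by blast
  then obtain \<kappa> where \<kappa>: "\<And>i. i < m \<Longrightarrow> \<kappa> i < n"
      "\<And>i l. i < m \<Longrightarrow> l < n \<Longrightarrow> Poly_Mapping.lookup s (i, l) = (if l = \<kappa> i then 1 else 0)"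
    unfolding bchoice_iff by auto
  have ev: "ev (\<lambda>i. e n (\<kappa> i)) t = (if t = s then 1 else 0)" if t: "ml_monom n m {..<m} t" for t
  proof (cases "t = s")
    case True
    have "(case a of (i, k) \<Rightarrow> (e n (\<kappa> i) $ k) ^ Poly_Mapping.lookup s (i, k)) = 1"
      if a: "a \<in> Poly_Mapping.keys s" for a
    proof -
      obtain i k where ik: "a = (i, k)" by (cases a)
      have lt: "i < m" "k < n" using s a ik by (auto simp: ml_monom_def)
      then have "k = \<kappa> i" using \<kappa>(2)[of i k] a ik by (auto simp: in_keys_iff split: if_splits)
      then show ?thesis using lt ik by simp
    qed
    then show ?thesis using True unfolding ev_def by (simp add: prod.neutral)
  next
    case False
    have "\<exists>a\<in>Poly_Mapping.keys t. snd a \<noteq> \<kappa> (fst a)"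
    proof (rule ccontr)
      assume all: "\<not> ?thesis"
      have "Poly_Mapping.lookup t (i, l) = Poly_Mapping.lookup s (i, l)" for i l
      proof (cases "i < m \<and> l < n")
        case True
        then obtain k where k: "k < n" "\<And>l. l < n \<Longrightarrow> Poly_Mapping.lookup t (i, l) = (if l = k then 1 else 0)"
          using ml_monom_coordinate[OF t, of i] by auto
        then have "(i, k) \<in> Poly_Mapping.keys t" by (simp add: in_keys_iff)
        then have "k = \<kappa> i" using all by fastforce
        then show ?thesis using k(2)[of l] \<kappa>(2)[of i l] True by simp
      next
        case out: False
        then have "(i, l) \<notin> Poly_Mapping.keys t" "(i, l) \<notin> Poly_Mapping.keys s"
          using s t by (auto simp: ml_monom_def)
        then show ?thesis by (simp add: in_keys_iff)
      qed
      then have "t = s" by (intro poly_mapping_eqI) auto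
      then show False using False by contradiction
    qed
    then obtain i k where ik: "(i, k) \<in> Poly_Mapping.keys t" "k \<noteq> \<kappa> i" by auto
    then have "i < m" "k < n" using t by (auto simp: ml_monom_def)
    then have "(e n (\<kappa> i) $ k) ^ Poly_Mapping.lookup t (i, k) = 0"
      using ik \<kappa>(1)[of i] by (simp add: in_keys_iff)
    then have "ev (\<lambda>i. e n (\<kappa> i)) t = 0"
      unfolding ev_def using ik(1) by (intro prod_zero bexI[of _ "(i, k)"]) auto
    then show ?thesis using False by simp
  qed
  have "poly_at f (\<lambda>i. e n (\<kappa> i)) = (\<Sum>t\<in>Poly_Mapping.keys f. if t = s then Poly_Mapping.lookup f t else 0)"
    unfolding poly_at_conv_lin lin_def using f
    by (intro sum.cong refl) (auto simp: ev ml_polys_def)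
  also have "\<dots> = Poly_Mapping.lookup f s" by (simp add: in_keys_iff)
  finally show ?thesis using that[of \<kappa>] \<kappa>(1) by simp
qed

lemma two_powi_diff:
  assumes "q \<le> p"
  shows "(2::complex) powi (int q - int p) = 1 / 2 ^ (p - q)"
proof -
  have "int q - int p = - int (p - q)" using assms by simp
  then show ?thesis by (simp only: power_int_minus power_int_of_nat) (simp add: inverse_eq_divide)
qed

text \<open>
  The coefficients of \<open>g_tilde\<close> are its values at tuples of basis vectors. These are isotropic and
  there are only \<open>n\<close> of them, so the Pfaffian is divisible by the denominator of \<open>g_tilde\<close>.
\<close>

lemma g_tilde_integral:
  assumes nm: "even n" "even m" "n \<le> m"
  shows "Poly_Mapping.lookup (g_tilde n m) s \<in> \<int>"
proof (cases "Poly_Mapping.lookup (g_tilde n m) s = 0")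
  case False
  let ?\<mu> = "m div 2" and ?\<nu> = "n div 2"
  have "ml_monom n m {..<m} s"
    using g_tilde_ml[OF nm(2)] False by (simp add: ml_polys_lookup)
  then obtain \<kappa> where \<kappa>: "\<And>i. i < m \<Longrightarrow> \<kappa> i < n"
      and eq: "Poly_Mapping.lookup (g_tilde n m) s = poly_at (g_tilde n m) (\<lambda>i. e n (\<kappa> i))"
    using ml_polys_lookup_conv_poly_at[OF g_tilde_ml[OF nm(2)]] by blast
  have "2 ^ (?\<mu> - ?\<nu>) dvd list_pf (hyp n) ?\<mu> (map \<kappa> [0..<m])"
  proof (rule list_pf_dvd)
    show "hyp n x y = hyp n y x" for x y by (auto simp: hyp_def)
    show "hyp n x x = 0" for x by (simp add: hyp_def)
    show "finite {..<n}" "card {..<n} \<le> 2 * ?\<nu>" using nm by auto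
    show "length (map \<kappa> [0..<m]) = 2 * ?\<mu>" "set (map \<kappa> [0..<m]) \<subseteq> {..<n}" using nm \<kappa> by auto
  qed
  then obtain z where z: "list_pf (hyp n) ?\<mu> (map \<kappa> [0..<m]) = 2 ^ (?\<mu> - ?\<nu>) * z" by blast
  have "list_pf (bil n) ?\<mu> (map (\<lambda>i. e n (\<kappa> i)) [0..<m]) = list_pf (\<lambda>k l. of_int (hyp n k l)) ?\<mu> (map \<kappa> [0..<m])"
    using nm by (simp add: list_pf_map bil_unit)
  also have "\<dots> = of_int (list_pf (hyp n) ?\<mu> (map \<kappa> [0..<m]))"
    by (rule list_pf_hom[symmetric]) simp_all
  also have "\<dots> = 2 ^ (?\<mu> - ?\<nu>) * of_int z" by (simp add: z)
  finally have "Poly_Mapping.lookup (g_tilde n m) s = of_int z"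
    using nm unfolding eq by (simp add: poly_at_g_tilde two_powi_diff div_le_mono)
  then show ?thesis by simp
qed simp

lemma g_tilde_invariants_int:
  assumes "even n" "even m" "n \<le> m"
  shows "g_tilde n m \<in> invariants_int n m"
  using g_tilde_invariant[OF assms(2)] g_tilde_integral[OF assms] ml_polys_R[OF g_tilde_ml[OF assms(2)]]
  by (simp add: invariants_int_def R_int_def)

lemma alt_sum_eq_0:
  assumes "\<And>y ys. y \<in> set xs \<Longrightarrow> f y ys = 0"
  shows "alt_sum f xs = 0"
  using assms by (induction xs arbitrary: f) simp_all

lemma alt_sum_replicate:
  assumes "\<And>y ys. y \<in> set ws \<Longrightarrow> f y ys = 0"
  shows "alt_sum f (replicate N v @ ws) = (if odd N then f v (replicate (N - 1) v @ ws) else 0)"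
  using assms
proof (induction N arbitrary: f)
  case 0
  then show ?case by (simp add: alt_sum_eq_0)
next
  case (Suc N)
  have "alt_sum (\<lambda>y ys. f y (v # ys)) (replicate N v @ ws) =
      (if odd N then f v (v # replicate (N - 1) v @ ws) else 0)"
    by (rule Suc.IH) (use Suc.prems in auto)
  moreover have "f v (v # replicate (N - 1) v @ ws) = f v (replicate N v @ ws)" if "odd N"
    using that by (cases N) auto
  ultimately show ?case by auto
qed

lemma list_pf_hyperbolic_pairs:
  assumes "even n" "r \<le> n div 2"
  shows "list_pf (bil n) (n div 2 - r) (map (e n) [2 * r..<n]) = 1"
  using assms(2)
proof (induction "n div 2 - r" arbitrary: r)
  case 0
  then show ?case by simp
next
  case (Suc k)
  have r: "2 * r + 1 < n" "r < n div 2" using Suc.hyps(2) assms(1) by auto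
  have k: "k = n div 2 - Suc r" using Suc.hyps(2) by simp
  have list: "[2 * r..<n] = 2 * r # (2 * r + 1) # [2 * Suc r..<n]"
    using r by (simp add: upt_rec)
  have "alt_sum (\<lambda>y ys. bil n (e n (2 * r)) y * list_pf (bil n) k (e n (2 * r + 1) # ys)) (map (e n) [2 * Suc r..<n]) = 0"
    by (rule alt_sum_eq_0) (auto simp: bil_unit hyp_def)
  moreover have "list_pf (bil n) k (map (e n) [2 * Suc r..<n]) = 1"
    using Suc.hyps(1)[OF k] r(2) unfolding k[symmetric] by simp
  moreover have "bil n (e n (2 * r)) (e n (2 * r + 1)) = 1"
    using r by (simp add: bil_unit hyp_def)
  ultimately show ?case unfolding list Suc.hyps(2)[symmetric] by (simp del: upt_Suc)
qed

lemma list_pf_replicate: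
  assumes "\<And>y. y \<in> set ws \<Longrightarrow> b v y = 0"
  shows "list_pf b (c + k) (replicate (2 * c) v @ ws) = b v v ^ c * list_pf b k ws"
proof (induction c)
  case (Suc c)
  have "replicate (2 * Suc c) v = v # replicate (2 * c + 1) v" by simp
  then have "list_pf b (Suc c + k) (replicate (2 * Suc c) v @ ws)
      = alt_sum (\<lambda>y ys. b v y * list_pf b (c + k) ys) (replicate (2 * c + 1) v @ ws)"
    by (simp only: append_Cons add_Suc list_pf.simps list.sel)
  also have "\<dots> = b v v * list_pf b (c + k) (replicate (2 * c) v @ ws)"
    by (subst alt_sum_replicate) (simp_all add: assms)
  also have "\<dots> = b v v ^ Suc c * list_pf b k ws" unfolding Suc.IH by simp
  finally show ?case .
qed simp

text \<open>
  Only an entry \<open>(y\<^sub>0, x\<^sub>0 + y\<^sub>0)\<close> of the first row contributes, with value \<open>1\<close>. Then \<open>m - n\<close> copies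
  of \<open>x\<^sub>0 + y\<^sub>0\<close> remain, of which each pair gives a factor \<open>2\<close>, and the hyperbolic planes contribute
  \<open>1\<close>. The power of \<open>2\<close> is exactly the normalising denominator.
\<close>

lemma poly_at_g_tilde_probe:
  assumes n: "2 \<le> n" "n < m" "even n" "even m"
  shows "poly_at (g_tilde n m) (probe n m) = 1"
proof -
  define c where "c = m div 2 - n div 2"
  let ?v = "e n 0 + e n 1" and ?ws = "map (e n) [2..<n]"
  have m: "m = 2 * c + n" "m div 2 = Suc (c + (n div 2 - 1))"
    using n unfolding c_def by (auto elim!: evenE)
  have ws: "bil n (e n 1) y = 0" "bil n ?v y = 0" if "y \<in> set ?ws" for y
    using that by (auto simp: bil_add_left[of _ n] bil_unit hyp_def)
  have uv: "bil n (e n k) ?v = bil n (e n 0) (e n k) + bil n (e n 1) (e n k)" for k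
    by (subst bil_sym) (simp add: bil_add_left)
  have vv: "bil n (e n 1) ?v = 1" "bil n ?v ?v = 2"
    using n by (simp_all add: bil_add_left[of _ n] uv[simplified] bil_unit hyp_def)
  have list: "map (probe n m) [0..<m] = e n 1 # replicate (2 * c + 1) ?v @ ?ws"
  proof (rule nth_equalityI)
    show "length (map (probe n m) [0..<m]) = length (e n 1 # replicate (2 * c + 1) ?v @ ?ws)"
      using n m by simp
    fix i assume "i < length (map (probe n m) [0..<m])"
    then have i: "i < m" by simp
    show "map (probe n m) [0..<m] ! i = (e n 1 # replicate (2 * c + 1) ?v @ ?ws) ! i"
    proof (cases i)
      case (Suc j)
      then show ?thesis using i m n by (auto simp: probe_def nth_append simp del: replicate_Suc)
    qed (use i in \<open>simp add: probe_def\<close>)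
  qed
  have "list_pf (bil n) (m div 2) (map (probe n m) [0..<m])
      = alt_sum (\<lambda>y ys. bil n (e n 1) y * list_pf (bil n) (c + (n div 2 - 1)) ys) (replicate (2 * c + 1) ?v @ ?ws)"
    by (simp only: list m(2) list_pf.simps list.sel)
  also have "\<dots> = list_pf (bil n) (c + (n div 2 - 1)) (replicate (2 * c) ?v @ ?ws)"
    by (subst alt_sum_replicate) (use ws vv in simp_all)
  also have "\<dots> = 2 ^ c * list_pf (bil n) (n div 2 - 1) ?ws"
    by (subst list_pf_replicate) (use ws vv in simp_all)
  also have "list_pf (bil n) (n div 2 - 1) ?ws = 1"
    using list_pf_hyperbolic_pairs[of n 1] n by simp
  finally show ?thesis
    using n by (simp add: poly_at_g_tilde two_powi_diff div_le_mono c_def)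
qed

section \<open>Indecomposability\<close>

lemma invariants_int_diff:
  assumes "f \<in> invariants_int n m" "g \<in> invariants_int n m"
  shows "f - g \<in> invariants_int n m"
proof -
  have "Poly_Mapping.keys (f - g) \<subseteq> Poly_Mapping.keys f \<union> Poly_Mapping.keys g"
    by (auto simp: in_keys_iff lookup_minus)
  then show ?thesis
    using assms by (auto simp: invariants_int_def invariants_def R_int_def R_def poly_at_diff lookup_minus)
qed

lemma lookup_mult_Ints:
  assumes "\<And>s. Poly_Mapping.lookup f s \<in> \<int>" "\<And>s. Poly_Mapping.lookup (g :: cpoly) s \<in> \<int>"
  shows "Poly_Mapping.lookup (f * g) s \<in> \<int>"
proof -
  have "Poly_Mapping.lookup (f * g) s = lin (\<lambda>t. if t = s then 1 else 0) (f * g)"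
    by (auto simp: lin_def in_keys_iff if_distrib[of "(*) _"] cong: if_cong)
  also have "\<dots> \<in> \<int>"
    unfolding lin_mult by (intro Ints_sum Ints_mult assms) auto
  finally show ?thesis .
qed

lemma invariants_int_mult:
  assumes "f \<in> invariants_int n m" "g \<in> invariants_int n m"
  shows "f * g \<in> invariants_int n m"
proof -
  have "Poly_Mapping.keys s \<subseteq> {..<m} \<times> {..<n}" if "s \<in> Poly_Mapping.keys (f * g)" for s
  proof -
    obtain a b where "s = a + b" "a \<in> Poly_Mapping.keys f" "b \<in> Poly_Mapping.keys g"
      using \<open>s \<in> Poly_Mapping.keys (f * g)\<close> keys_mult[of f g] by blast
    then show ?thesis
      using assms unfolding invariants_int_def R_int_def R_def by (simp add: keys_add_monom)
  qed
  then have "f * g \<in> R n m" by (simp add: R_def)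
  then show ?thesis
    using assms lookup_mult_Ints[of f g] by (auto simp: invariants_int_def invariants_def R_int_def poly_at_mult)
qed

lemma invariants_int_one: "1 \<in> invariants_int n m"
  by (auto simp: invariants_int_def invariants_def R_int_def R_def lookup_one when_def)

text \<open>
  In the expansion of the value of \<open>f * g\<close> over complementary index sets, let \<open>W\<close> be the set
  containing \<open>0\<close>. If \<open>W\<close> misses some argument \<open>x\<^sub>0 + y\<^sub>0\<close>, the factor of the complement is even. If
  \<open>W\<close> contains all of them but not all indices, the factor of \<open>W\<close> is even by a free or half-used
  plane. If \<open>W\<close> contains all indices, the factor of \<open>W\<close> is even by hypothesis.
\<close>

lemma mlpart_probe_mult_even:
  assumes n: "2 \<le> n" "n < m" "even n" "even m"
    and f: "f \<in> invariants_int n m" "mlpart n m {..<m} f (probe n m) / 2 \<in> \<int>"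
    and g: "g \<in> invariants_int n m" "mlpart n m {..<m} g (probe n m) / 2 \<in> \<int>"
  shows "mlpart n m {..<m} (f * g) (probe n m) / 2 \<in> \<int>"
proof -
  let ?F = "\<lambda>T. mlpart n m T f (probe n m)" and ?G = "\<lambda>T. mlpart n m T g (probe n m)"
  have one_side: "mlpart n m W h (probe n m) / 2 \<in> \<int> \<or> mlpart n m U k (probe n m) / 2 \<in> \<int>"
    if h: "h \<in> invariants_int n m" "mlpart n m {..<m} h (probe n m) / 2 \<in> \<int>" and k: "k \<in> invariants_int n m"
      and WU: "W \<subseteq> {..<m}" "U = {..<m} - W" "0 \<in> W" for h k W U
  proof (cases "{..<m - n + 2} \<subseteq> W")
    case True
    show ?thesis
    proof (cases "W = {..<m}")
      case False
      then show ?thesis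
        using mlpart_probe_even_incomplete[OF h(1) n WU(1) False True] by blast
    qed (use h(2) in simp)
  next
    case False
    then obtain i where "i < m - n + 2" "i \<notin> W" by auto
    moreover from this n have "i \<in> U" using WU by auto
    ultimately show ?thesis
      using mlpart_probe_even_without_0[OF k n(1,2), of U i] WU by auto
  qed
  have even_term: "?F U * ?G ({..<m} - U) / 2 \<in> \<int>" if U: "U \<subseteq> {..<m}" for U
  proof -
    have int: "?F T \<in> \<int>" "?G T \<in> \<int>" for T
      using f(1) g(1) by (auto intro: mlpart_integral)
    have "?F U / 2 \<in> \<int> \<or> ?G ({..<m} - U) / 2 \<in> \<int>"
    proof (cases "0 \<in> U")
      case True
      then show ?thesis using one_side[OF f g(1) U refl] by blast
    next
      case False
      then show ?thesis using one_side[OF g f(1), of "{..<m} - U" U] U n by auto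
    qed
    then show ?thesis
    proof
      assume "?F U / 2 \<in> \<int>"
      from Ints_mult[OF this int(2)] show ?thesis by simp
    next
      assume "?G ({..<m} - U) / 2 \<in> \<int>"
      from Ints_mult[OF int(1) this] show ?thesis by simp
    qed
  qed
  show ?thesis
    unfolding mlpart_mult[OF subset_refl] sum_divide_distrib by (intro Ints_sum even_term) auto
qed

theorem mainTheorem7:
  fixes n m :: nat
  assumes "even n" and "even m" and "n \<ge> 2" and "m > n"
  shows "m_linear n m (g_tilde n m) \<and> indecomposable n m (g_tilde n m)"
proof -
  let ?g = "g_tilde n m"
  let ?S = "{f \<in> invariants_int n m. mlpart n m {..<m} f (probe n m) / 2 \<in> \<int>}"
  let ?X = "{h \<in> invariants_int n m. total_degree h < total_degree ?g}"
  have ml: "?g \<in> ml_polys n m {..<m}" by (rule g_tilde_ml) fact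
  have "is_subring ?S"
    unfolding is_subring_def
  proof (intro conjI ballI)
    show "1 \<in> ?S" using invariants_int_one mlpart_one[of 0 "{..<m}" m n] assms by simp
  next
    fix f g assume fg: "f \<in> ?S" "g \<in> ?S"
    then show "f - g \<in> ?S" by (auto simp: invariants_int_diff mlpart_diff diff_divide_distrib)
    show "f * g \<in> ?S" using fg mlpart_probe_mult_even[OF assms(3,4,1,2)] by (auto simp: invariants_int_mult)
  qed
  moreover have "?X \<subseteq> ?S"
    using total_degree_ml_polys[OF ml] by (auto simp: mlpart_low_degree)
  ultimately have "is_subring hull ?X \<subseteq> ?S" by (intro hull_minimal)
  moreover have "?g \<notin> ?S"
  proof -
    have "(1 / 2 :: complex) \<notin> \<int>"
    proof
      assume "(1 / 2 :: complex) \<in> \<int>"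
      then obtain z where "(1 / 2 :: complex) = of_int z" by (elim Ints_cases)
      then have "of_int (2 * z) = (of_int 1 :: complex)" by (simp add: field_simps)
      then have "2 * z = 1" unfolding of_int_eq_iff .
      then show False by presburger
    qed
    then show ?thesis
      using poly_at_g_tilde_probe[OF assms(3,4,1,2)] by (simp add: mlpart_ml_polys[OF ml])
  qed
  ultimately have "?g \<notin> is_subring hull ?X" by blast
  then show ?thesis
    using ml_polys_m_linear[OF ml] g_tilde_invariants_int assms by (auto simp: indecomposable_def)
qed

end
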